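(* Let $a\ge 2$ and let $D$ be a strong balanced bipartite digraph on $2a$ vertices. Suppose that for every dominating pair of vertices $\{x,y\}$ in $D$, either $d(x)\ge 2a-2$ and $d(y)\ge a+1$, or $d(y)\ge 2a-2$ and $d(x)\ge a+1$. Then $D$ is either hamiltonian or isomorphic to one of the digraphs $H_1$, $H_2$ and $H_3$ (where $H_2$ stands for either of its two variants).
   Context: Digraphs are finite, without loops and without multiple arcs (both arcs $xy$ and $yx$ may be present). Write $x\rightarrow y$ if there is an arc from $x$ to $y$, and $x\leftrightarrow y$ if both $x\rightarrow y$ and $y\rightarrow x$. A digraph is bipartite if its vertex set is a disjoint union of two independent sets $V_1,V_2$ (the partite sets), and balanced if $|V_1|=|V_2|$. It is strong if for every two vertices $x,y$ there is a directed path from $x$ to $y$. A pair $\{x,y\}$ of distinct vertices is dominating if there is a vertex $z$ with $x\rightarrow z$ and $y\rightarrow z$. The degree of a vertex $v$ is $d(v)=d^+(v)+d^-(v)$, the sum of its out-degree and in-degree in $D$. $D$ is hamiltonian if it contains a directed cycle through every vertex of $D$. Isomorphism means isomorphism of digraphs (it need not respect the names of the partite sets). The digraph $H_1$ has vertices $x_1,x_2,y_1,y_2$ and exactly the arcs given by $x_1\leftrightarrow y_1$, $y_1\leftrightarrow x_2$, $x_2\leftrightarrow y_2$. The digraph $H_2$ has vertices $x_1,x_2,x_3,y_1,y_2,y_3$ and the arcs given by $y_1\leftrightarrow x_1$, $y_1\leftrightarrow x_2$, $y_2\leftrightarrow x_3$, $y_3\leftrightarrow x_3$, $y_2\rightarrow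 x_1$, $y_2\rightarrow x_2$, $y_3\rightarrow x_1$, $y_3\rightarrow x_2$, $y_1\rightarrow x_3$; in addition the arc $x_3\rightarrow y_1$ may be present or not (so $H_2$ denotes two digraphs), and there are no other arcs. The digraph $H_3$ has vertices $x_1,x_2,x_3,y_1,y_2,y_3$ and exactly the arcs given by $y_3\leftrightarrow x_1$, $y_3\leftrightarrow x_2$, $x_3\leftrightarrow y_1$, $x_3\leftrightarrow y_2$, $x_1\rightarrow y_2$, $y_2\rightarrow x_2$, $x_2\rightarrow y_1$, $y_1\rightarrow x_1$. *)

theory Defs
  imports "Graph_Theory.Graph_Theory"
begin

definition independent_set :: "('a, 'b) pre_digraph \<Rightarrow> 'a set \<Rightarrow> bool" where
  "independent_set G S \<longleftrightarrow> S \<subseteq> verts G \<and> (\<forall>u\<in>S. \<forall>v\<in>S. \<not> u \<rightarrow>\<^bsub>G\<^esub> v)"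

definition bipartition :: "('a, 'b) pre_digraph \<Rightarrow> 'a set \<Rightarrow> 'a set \<Rightarrow> bool" where
  "bipartition G V1 V2 \<longleftrightarrow>
     verts G = V1 \<union> V2 \<and> V1 \<inter> V2 = {} \<and> independent_set G V1 \<and> independent_set G V2"

definition balanced_bipartite :: "('a, 'b) pre_digraph \<Rightarrow> bool" where
  "balanced_bipartite G \<longleftrightarrow> (\<exists>V1 V2. bipartition G V1 V2 \<and> card V1 = card V2)"

definition dominating_pair :: "('a, 'b) pre_digraph \<Rightarrow> 'a \<Rightarrow> 'a \<Rightarrow> bool" where
  "dominating_pair G x y \<longleftrightarrow>
     x \<in> verts G \<and> y \<in> verts G \<and> x \<noteq> y \<and> (\<exists>z\<in>verts G. x \<rightarrow>\<^bsub>G\<^esub> z \<and> y \<rightarrow>\<^bsub>G\<^esub> z)"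

definition total_degree :: "('a, 'b) pre_digraph \<Rightarrow> 'a \<Rightarrow> nat" where
  "total_degree G v = out_degree G v + in_degree G v"

text \<open>The library represents a cycle as the list of arcs of a closed walk without repeated
  vertices, so the vertices on the cycle \<open>p\<close> are the tails of the arcs in \<open>p\<close>.\<close>

definition hamiltonian :: "('a, 'b) pre_digraph \<Rightarrow> bool" where
  "hamiltonian G \<longleftrightarrow> (\<exists>p. pre_digraph.cycle G p \<and> tail G ` set p = verts G)"

datatype hvert = x1 | x2 | x3 | y1 | y2 | y3

definition both_ways :: "'a rel \<Rightarrow> 'a rel" where
  "both_ways R = R \<union> R\<inverse>"

definition H1 :: "(hvert, hvert \<times> hvert) pre_digraph" where
  "H1 = with_proj \<lparr> pverts = {x1, x2, y1, y2},
     parcs = both_ways {(x1, y1), (y1, x2), (x2, y2)} \<rparr>"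

text \<open>The flag says whether the optional arc from \<open>x3\<close> to \<open>y1\<close> is present.\<close>

definition H2 :: "bool \<Rightarrow> (hvert, hvert \<times> hvert) pre_digraph" where
  "H2 opt = with_proj \<lparr> pverts = {x1, x2, x3, y1, y2, y3},
     parcs = both_ways {(y1, x1), (y1, x2), (y2, x3), (y3, x3)}
       \<union> {(y2, x1), (y2, x2), (y3, x1), (y3, x2), (y1, x3)}
       \<union> (if opt then {(x3, y1)} else {}) \<rparr>"

definition H3 :: "(hvert, hvert \<times> hvert) pre_digraph" where
  "H3 = with_proj \<lparr> pverts = {x1, x2, x3, y1, y2, y3},
     parcs = both_ways {(y3, x1), (y3, x2), (x3, y1), (x3, y2)}
       \<union> {(x1, y2), (y2, x2), (x2, y1), (y1, x1)} \<rparr>"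

end

theory Submission
  imports Defs
begin

text \<open>Hall's condition can fail only for \<open>a = 3\<close>, and then \<open>D\<close> is \<open>H2\<close>; otherwise there is a
  permutation \<open>\<sigma>\<close> of the vertices along arcs, that is, a cycle factor. Choose \<open>\<sigma>\<close> such that as many
  pairs of vertices as possible lie on a common cycle. If \<open>u\<close> and \<open>v\<close> lie on different cycles, then
  \<open>u \<rightarrow> \<sigma> v\<close> and \<open>v \<rightarrow> \<sigma> u\<close> cannot both hold, since exchanging the successors would merge the two
  cycles. So at least half of the possible arcs between a cycle with \<open>2c\<close> vertices and the rest are
  missing, and the degrees on this cycle sum up to at most \<open>2c(a - c)\<close> plus twice the number of
  arcs inside. On the other hand, distinct vertices of degree less than \<open>2a - 2\<close> have no common
  out-neighbour, so there are few of them on the cycle. For \<open>a \<ge> 4\<close>, applying this to a cycle with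
  \<open>2c \<le> a\<close> leaves only near-extremal situations (a 2-cycle, or \<open>a \<le> c + 3\<close>), each of which
  contradicts maximality or strongness. The remaining cases \<open>a = 2\<close> and \<open>a = 3\<close> give \<open>H1\<close> and
  \<open>H3\<close>.\<close>

section \<open>Hall's theorem and translation to relations\<close>

text \<open>For \<open>a \<ge> 4\<close> the thresholds satisfy \<open>a + 1 < 2 * a - 2\<close>, so
  a vertex of degree \<open>a + 1\<close> forces every vertex sharing an out-neighbour with it to
  have degree at least \<open>2 * a - 2\<close>. For \<open>a = 3\<close> they coincide and this
  lever is lost, hence the separate treatment. The hypothesis is silent about vertices in no
  dominating pair, so a lower bound on all degrees must first be extracted from maximality. The
  degree sum on a cycle is a trade-off: a vertex of degree below \<open>2 * a - 2\<close> lowers the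
  required sum by at most \<open>a - 3\<close>, but every vertex has at most one such in-neighbour,
  so many of them cost arcs inside the cycle. Balancing the two effects gives the borderline
  \<open>a = c + 3\<close>. There the estimates have no slack, which is why the counting lemmas also
  record what equality means: of the two arcs \<open>u \<rightarrow> \<sigma> p\<close> and
  \<open>p \<rightarrow> \<sigma> u\<close> at least one is present. This information settles the
  extremal cases.\<close>

lemma hall_marriage:
  fixes N :: "'i \<Rightarrow> 'b set"
  assumes "finite I" and "\<And>i. i \<in> I \<Longrightarrow> finite (N i)"
    and "\<And>J. J \<subseteq> I \<Longrightarrow> card J \<le> card (\<Union>(N ` J))"
  shows "\<exists>f. inj_on f I \<and> (\<forall>i\<in>I. f i \<in> N i)"
  using assms
proof (induction "\<Sum>i\<in>I. card (N i)" arbitrary: N rule: less_induct)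
  case less
  note fin = less.prems(1,2) and hall = less.prems(3)
  have ge1: "card (N i) \<ge> 1" if "i \<in> I" for i
    using hall[of "{i}"] that by simp
  show ?case
  proof (cases "\<forall>i\<in>I. card (N i) = 1")
    case True
    then have "\<forall>i\<in>I. \<exists>b. N i = {b}"
      by (simp add: card_1_singleton_iff)
    then obtain f where f: "\<And>i. i \<in> I \<Longrightarrow> N i = {f i}"
      by metis
    have "inj_on f I"
    proof (rule inj_onI)
      fix i j assume "i \<in> I" "j \<in> I" "f i = f j"
      then show "i = j"
        using hall[of "{i, j}"] f by (cases "i = j") auto
    qed
    then show ?thesis using f by blast
  next
    case False
    then obtain k where k: "k \<in> I" "card (N k) \<noteq> 1" by blast
    with ge1 have "\<not> card (N k) \<le> 1"
      by (metis le_antisym)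
    then obtain p q where pq: "p \<in> N k" "q \<in> N k" "p \<noteq> q"
      using fin(2)[OF k(1)] by (metis card_le_Suc0_iff_eq One_nat_def)
    \<comment> \<open>Rado's argument: one of two elements \<open>p\<close>, \<open>q\<close> of
      \<open>N k\<close> can be deleted without destroying Hall's condition. If both deletions
      failed, on families \<open>insert k J\<close> and \<open>insert k K\<close>, then counting
      unions and intersections would make \<open>insert k (J \<union> K)\<close> or
      \<open>J \<inter> K\<close> violate the condition for \<open>N\<close> itself.\<close>
    define R where "R b = N(k := N k - {b})" for b
    have red: "(\<Sum>i\<in>I. card (R b i)) < (\<Sum>i\<in>I. card (N i))" if "b \<in> N k" for b
    proof (rule sum_strict_mono_ex1[OF fin(1)])
      show "\<forall>i\<in>I. card (R b i) \<le> card (N i)"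
        using fin(2) by (auto simp: R_def intro!: card_mono)
      show "\<exists>i\<in>I. card (R b i) < card (N i)"
        using k(1) fin(2)[OF k(1)] that card_Diff1_less[of "N k" b] by (auto simp: R_def intro!: bexI[of _ k])
    qed
    have finR: "finite (R b i)" if "i \<in> I" for b i
      using fin(2) that by (auto simp: R_def)
    have good: ?thesis if b: "b \<in> N k" and h: "\<And>J. J \<subseteq> I \<Longrightarrow> card J \<le> card (\<Union>(R b ` J))" for b
    proof -
      obtain f where f: "inj_on f I" "\<forall>i\<in>I. f i \<in> R b i"
        using less.hyps[OF red[OF b] fin(1) finR h] by blast
      have "f i \<in> N i" if "i \<in> I" for i
        using f(2) that by (auto simp: R_def split: if_splits)
      with f(1) show ?thesis by blast
    qed
    show ?thesis
    proof (rule ccontr)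
      assume no: "\<not> ?thesis"
      have ex: "\<exists>J. J \<subseteq> I - {k} \<and> card (\<Union>(N ` J) \<union> (N k - {b})) \<le> card J" if b: "b \<in> N k" for b
      proof -
        obtain J where J: "J \<subseteq> I" "card (\<Union>(R b ` J)) < card J"
          using good[OF b] no by (meson not_le)
        have "k \<in> J"
        proof (rule ccontr)
          assume "k \<notin> J"
          then have "R b ` J = N ` J" by (auto simp: R_def intro!: image_cong)
          then show False using hall[OF J(1)] J(2) by simp
        qed
        moreover have "\<Union>(R b ` J) = \<Union>(N ` (J - {k})) \<union> (N k - {b})"
          using \<open>k \<in> J\<close> by (auto simp: R_def split: if_splits)
        moreover have "card J = Suc (card (J - {k}))"
          using \<open>k \<in> J\<close> J(1) fin(1) by (metis card.remove finite_subset)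
        ultimately show ?thesis using J by (intro exI[of _ "J - {k}"]) auto
      qed
      obtain J where J: "J \<subseteq> I - {k}" "card (\<Union>(N ` J) \<union> (N k - {p})) \<le> card J"
        using ex[OF pq(1)] by blast
      obtain K where K: "K \<subseteq> I - {k}" "card (\<Union>(N ` K) \<union> (N k - {q})) \<le> card K"
        using ex[OF pq(2)] by blast
      let ?A = "\<Union>(N ` J) \<union> (N k - {p})" and ?B = "\<Union>(N ` K) \<union> (N k - {q})"
      have finJK: "finite J" "finite K" using J(1) K(1) fin(1) by (auto intro: finite_subset)
      have finAB: "finite ?A" "finite ?B"
        using J(1) K(1) fin(2) finJK k(1) by (auto intro!: finite_UN_I)
      have un: "?A \<union> ?B = \<Union>(N ` insert k (J \<union> K))"
        using pq by auto
      have "card (insert k (J \<union> K)) = Suc (card (J \<union> K))"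
        using J(1) K(1) finJK by (intro card_insert_disjoint) auto
      moreover have "card (insert k (J \<union> K)) \<le> card (?A \<union> ?B)"
        unfolding un using hall[of "insert k (J \<union> K)"] J(1) K(1) k(1) by blast
      moreover have "card (J \<inter> K) \<le> card (?A \<inter> ?B)"
      proof -
        have "card (J \<inter> K) \<le> card (\<Union>(N ` (J \<inter> K)))" using hall J(1) by (meson Diff_subset inf.coboundedI1 subset_trans)
        also have "\<dots> \<le> card (?A \<inter> ?B)" using finAB by (intro card_mono) auto
        finally show ?thesis .
      qed
      moreover have "card ?A + card ?B = card (?A \<union> ?B) + card (?A \<inter> ?B)"
        using finAB by (rule card_Un_Int)
      moreover have "card J + card K = card (J \<union> K) + card (J \<inter> K)"
        using finJK by (rule card_Un_Int)
      ultimately show False using J(2) K(2) by linarith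
    qed
  qed
qed

section \<open>Vertex lists and relational copies versus arc cycles and digraph isomorphisms\<close>

definition hamiltonian_list :: "'a set \<Rightarrow> ('a \<Rightarrow> 'a \<Rightarrow> bool) \<Rightarrow> 'a list \<Rightarrow> bool" where
  "hamiltonian_list V E vs \<longleftrightarrow>
     distinct vs \<and> set vs = V \<and> vs \<noteq> [] \<and> successively E vs \<and> E (last vs) (hd vs)"

text \<open>The map is taken from the small digraph to the large one, so that it can be given by listing
  the images of the named vertices.\<close>

definition isomorphic_copy ::
  "'a set \<Rightarrow> ('a \<Rightarrow> 'a \<Rightarrow> bool) \<Rightarrow> ('h, 'h \<times> 'h) pre_digraph \<Rightarrow> bool" where
  "isomorphic_copy V E H \<longleftrightarrow> (\<exists>g. bij_betw g (verts H) V \<and>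
     (\<forall>h\<in>verts H. \<forall>k\<in>verts H. (h, k) \<in> arcs H \<longleftrightarrow> E (g h) (g k)))"

lemma (in wf_digraph) hamiltonian_if_list:
  assumes "hamiltonian_list (verts G) (dominates G) vs"
  shows "hamiltonian G"
proof -
  obtain v ws where vs: "vs = v # ws"
    using assms by (auto simp: hamiltonian_list_def neq_Nil_conv)
  have path: "\<exists>p. cas u p w \<and> set p \<subseteq> arcs G \<and> awalk_verts u p = us @ [w] \<and> tail G ` set p = set us"
    if "successively (dominates G) us" "us \<noteq> []" "hd us = u" "last us \<rightarrow>\<^bsub>G\<^esub> w" for us u w
    using that
  proof (induction us arbitrary: u)
    case Nil
    then show ?case by simp
  next
    case (Cons t us)
    show ?case
    proof (cases us)
      case Nil
      then obtain e where "e \<in> arcs G" "tail G e = t" "head G e = w"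
        using Cons.prems by auto
      then show ?thesis using Cons.prems Nil by (intro exI[of _ "[e]"]) auto
    next
      case (Cons t' us')
      then have "t \<rightarrow>\<^bsub>G\<^esub> t'" using Cons.prems by simp
      then obtain e where e: "e \<in> arcs G" "tail G e = t" "head G e = t'" by auto
      obtain p where "cas t' p w" "set p \<subseteq> arcs G" "awalk_verts t' p = us @ [w]" "tail G ` set p = set us"
        using Cons.IH[of t'] Cons.prems \<open>us = t' # us'\<close> by auto
      then show ?thesis using e Cons.prems by (intro exI[of _ "e # p"]) auto
    qed
  qed
  obtain p where p: "cas v p v" "set p \<subseteq> arcs G" "awalk_verts v p = vs @ [v]" "tail G ` set p = set vs"
    using path[of vs v v] assms vs by (auto simp: hamiltonian_list_def)
  have "distinct (ws @ [v])" "v \<in> verts G" "verts G = set vs"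
    using assms vs by (auto simp: hamiltonian_list_def)
  moreover have "p \<noteq> []" using p(3) vs by auto
  ultimately have "cycle p \<and> tail G ` set p = verts G"
    using p vs by (auto simp: cycle_def awalk_def intro!: exI[of _ v])
  then show ?thesis by (auto simp: hamiltonian_def)
qed

text \<open>\<open>digraph_iso\<close> wants \<open>H\<close> to be literally
  \<open>app_iso hom G\<close>, so the given map is inverted and images of arcs, heads and tails are
  prescribed. Sending an arc to the images of its ends is injective because there are no parallel
  arcs, and the form \<open>with_proj P\<close> makes the head and tail functions of
  \<open>H\<close> the projections.\<close>

lemma (in digraph) digraph_iso_if_isomorphic_copy:
  fixes H :: "('h, 'h \<times> 'h) pre_digraph"
  assumes "isomorphic_copy (verts G) (dominates G) H"
    and H: "H = with_proj P" "arcs H \<subseteq> verts H \<times> verts H"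
  shows "digraph_iso G H"
proof -
  obtain g where g: "bij_betw g (verts H) (verts G)"
    and gE: "\<And>h k. h \<in> verts H \<Longrightarrow> k \<in> verts H \<Longrightarrow> (h, k) \<in> arcs H \<longleftrightarrow> g h \<rightarrow>\<^bsub>G\<^esub> g k"
    using assms(1) by (auto simp: isomorphic_copy_def)
  define f where "f = inv_into (verts H) g"
  have f: "bij_betw f (verts G) (verts H)"
    unfolding f_def by (rule bij_betw_inv_into[OF g])
  have gf: "g (f v) = v" if "v \<in> verts G" for v
    using that g by (auto simp: f_def bij_betw_def intro: f_inv_into_f)
  have fg: "f (g h) = h" if "h \<in> verts H" for h
    using that g by (auto simp: f_def bij_betw_def)
  have fV: "f v \<in> verts H" if "v \<in> verts G" for v
    using f that by (auto simp: bij_betw_def)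
  define hom where "hom = \<lparr>iso_verts = f, iso_arcs = (\<lambda>e. (f (tail G e), f (head G e))),
     iso_head = snd, iso_tail = (fst :: 'h \<times> 'h \<Rightarrow> 'h)\<rparr>"
  have inj: "inj_on f (verts G)" using f by (simp add: bij_betw_def)
  have "inj_on (iso_arcs hom) (arcs G)"
  proof (rule inj_onI)
    fix d e assume "d \<in> arcs G" "e \<in> arcs G" "iso_arcs hom d = iso_arcs hom e"
    then have "arc_to_ends G d = arc_to_ends G e"
      using inj by (auto simp: hom_def arc_to_ends_def inj_on_eq_iff)
    then show "d = e" using \<open>d \<in> arcs G\<close> \<open>e \<in> arcs G\<close> no_multi_arcs by blast
  qed
  then have "digraph_isomorphism hom"
    using inj by (auto simp: digraph_isomorphism_def hom_def wf_digraph)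
  moreover have "H = app_iso hom G"
  proof -
    have "iso_arcs hom ` arcs G = arcs H"
    proof (intro equalityI subsetI)
      fix x assume "x \<in> iso_arcs hom ` arcs G"
      then obtain e where e: "e \<in> arcs G" "x = (f (tail G e), f (head G e))"
        by (auto simp: hom_def)
      then have "tail G e \<rightarrow>\<^bsub>G\<^esub> head G e" by (auto simp: arcs_ends_conv)
      then show "x \<in> arcs H" using e gE[of "f (tail G e)" "f (head G e)"] by (simp add: gf fV)
    next
      fix x assume x: "x \<in> arcs H"
      then obtain h k where hk: "x = (h, k)" "h \<in> verts H" "k \<in> verts H" using H(2) by auto
      then obtain e where "e \<in> arcs G" "tail G e = g h" "head G e = g k"
        using gE x by blast
      then show "x \<in> iso_arcs hom ` arcs G"
        using hk by (intro image_eqI[of _ _ e]) (auto simp: hom_def fg)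
    qed
    moreover have "verts H = f ` verts G" using f by (simp add: bij_betw_def)
    ultimately show ?thesis
      using H(1) by (auto simp: app_iso_def hom_def with_proj_def)
  qed
  ultimately show ?thesis unfolding digraph_iso_def by blast
qed

lemma (in digraph) total_degree_conv:
  "total_degree G v = card {w. v \<rightarrow>\<^bsub>G\<^esub> w} + card {w. w \<rightarrow>\<^bsub>G\<^esub> v}"
proof -
  have "inj_on (head G) (out_arcs G v)" "inj_on (tail G) (in_arcs G v)"
    using no_multi_arcs by (auto simp: inj_on_def out_arcs_def in_arcs_def arc_to_ends_def)
  moreover have "head G ` out_arcs G v = {w. v \<rightarrow>\<^bsub>G\<^esub> w}" "tail G ` in_arcs G v = {w. w \<rightarrow>\<^bsub>G\<^esub> v}"
    by (auto simp: out_arcs_def in_arcs_def arcs_ends_conv image_iff)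
  ultimately show ?thesis
    unfolding total_degree_def out_degree_def in_degree_def by (metis card_image)
qed

lemma (in wf_digraph) strongly_connected_cut:
  assumes "strongly_connected G" "S \<subseteq> verts G" "S \<noteq> {}" "S \<noteq> verts G"
  shows "\<exists>u\<in>S. \<exists>v\<in>verts G - S. u \<rightarrow>\<^bsub>G\<^esub> v"
proof (rule ccontr)
  assume no: "\<not> ?thesis"
  obtain s t where st: "s \<in> S" "t \<in> verts G - S" using assms(2-4) by blast
  then have "s \<rightarrow>\<^sup>*\<^bsub>G\<^esub> t" using assms by (auto simp: strongly_connected_def)
  then have "t \<in> S"
    using no st(1) by (induction rule: reachable_induct) (auto dest: adj_in_verts)
  then show False using st by simp
qed

section \<open>Cycle factors\<close>

definition degree :: "('a \<Rightarrow> 'a \<Rightarrow> bool) \<Rightarrow> 'a \<Rightarrow> nat" where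
  "degree E v = card {w. E v w} + card {w. E w v}"

definition cycle_factor :: "'a set \<Rightarrow> ('a \<Rightarrow> 'a \<Rightarrow> bool) \<Rightarrow> ('a \<Rightarrow> 'a) \<Rightarrow> bool" where
  "cycle_factor V E \<sigma> \<longleftrightarrow> \<sigma> permutes V \<and> (\<forall>v\<in>V. E v (\<sigma> v))"

text \<open>The cardinality of this relation is the quantity to be maximised. Merging two cycles
  enlarges the relation itself, so strict growth follows from inclusion, without counting
  cycles.\<close>

definition orbit_rel :: "'a set \<Rightarrow> ('a \<Rightarrow> 'a) \<Rightarrow> 'a rel" where
  "orbit_rel V \<sigma> = Sigma V (orbit \<sigma>)"

lemma orbit_eq_if_mem:
  assumes "\<sigma> permutes V" "finite V" "w \<in> orbit \<sigma> v"
  shows "orbit \<sigma> w = orbit \<sigma> v"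
  using orbit_cyclic_eq3[OF cyclic_on_orbit[OF assms(1,2)] assms(3)] .

lemma orbit_self:
  assumes "\<sigma> permutes V" "finite V"
  shows "v \<in> orbit \<sigma> v"
  using assms permutation_self_in_orbit permutation_permutes by metis

lemma orbit_closed_subset:
  assumes "v \<in> S" "\<And>w. w \<in> S \<Longrightarrow> \<sigma> w \<in> S"
  shows "orbit \<sigma> v \<subseteq> S"
proof
  fix w assume "w \<in> orbit \<sigma> v"
  then show "w \<in> S" by induction (use assms in auto)
qed

lemma orbit_rel_finite:
  assumes "\<sigma> permutes V" "finite V"
  shows "orbit_rel V \<sigma> \<subseteq> V \<times> V" "finite (orbit_rel V \<sigma>)"
proof -
  show 1: "orbit_rel V \<sigma> \<subseteq> V \<times> V"
    using permutes_orbit_subset[OF assms(1)] by (auto simp: orbit_rel_def)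
  show "finite (orbit_rel V \<sigma>)"
    using finite_subset[OF 1] assms(2) by blast
qed

text \<open>From \<open>u\<close> the new permutation jumps to the old successor of
  \<open>v\<close>, follows the old cycle up to \<open>v\<close>, and then enters the old cycle of
  \<open>u\<close>. So these two cycles become one, and all others are untouched.\<close>

lemma orbit_merge:
  assumes perm: "\<sigma> permutes V" and fin: "finite V" and uv: "u \<in> V" "v \<in> V" "v \<notin> orbit \<sigma> u"
  defines "\<tau> \<equiv> \<sigma> \<circ> transpose u v"
  shows "\<tau> permutes V" "card (orbit_rel V \<sigma>) < card (orbit_rel V \<tau>)"
proof -
  show permt: "\<tau> permutes V"
    unfolding \<tau>_def using perm uv by (intro permutes_compose permutes_swap_id)
  note self = orbit_self[OF perm fin] orbit_self[OF permt fin]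
  note eqs = orbit_eq_if_mem[OF perm fin] orbit_eq_if_mem[OF permt fin]
  have \<tau>: "\<tau> u = \<sigma> v" "\<tau> v = \<sigma> u" "\<And>w. w \<noteq> u \<Longrightarrow> w \<noteq> v \<Longrightarrow> \<tau> w = \<sigma> w"
    by (auto simp: \<tau>_def)
  have u: "u \<notin> orbit \<sigma> v"
    using self(1) eqs(1) uv(3) by metis
  have sub: "orbit \<sigma> q \<subseteq> orbit \<tau> p"
    if pq: "\<tau> p = \<sigma> q" "p \<notin> orbit \<sigma> q" "\<tau> q = \<sigma> p" "\<And>w. w \<noteq> p \<Longrightarrow> w \<noteq> q \<Longrightarrow> \<tau> w = \<sigma> w" for p q
  proof
    fix w assume "w \<in> orbit \<sigma> q"
    then show "w \<in> orbit \<tau> p"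
    proof induction
      case base
      show ?case using orbit.base[of \<tau> p] pq(1) by simp
    next
      case (step w)
      show ?case
      proof (cases "w = q")
        case True
        then show ?thesis using orbit.base[of \<tau> p] pq(1) by simp
      next
        case False
        moreover have "w \<noteq> p" using step(1) pq(2) by blast
        ultimately have "\<tau> w = \<sigma> w" using pq(4) by simp
        then show ?thesis using orbit.step[OF step(2)] by simp
      qed
    qed
  qed
  have v_sub: "orbit \<sigma> v \<subseteq> orbit \<tau> u" by (rule sub) (use \<tau> u in auto)
  then have vu: "orbit \<tau> v = orbit \<tau> u" using self(1)[of v] eqs(2) by blast
  have u_sub: "orbit \<sigma> u \<subseteq> orbit \<tau> u" unfolding vu[symmetric] by (rule sub) (use \<tau> uv in auto)
  have "orbit \<sigma> w \<subseteq> orbit \<tau> w" if "w \<in> V" for w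
  proof (cases "w \<in> orbit \<sigma> u \<union> orbit \<sigma> v")
    case True
    then have "orbit \<tau> w = orbit \<tau> u" "orbit \<sigma> w = orbit \<sigma> u \<or> orbit \<sigma> w = orbit \<sigma> v"
      using eqs v_sub u_sub by blast+
    then show ?thesis using v_sub u_sub by auto
  next
    case False
    have "orbit \<tau> w = orbit \<sigma> w"
    proof (rule orbit_cong[OF self(1)])
      fix s assume "s \<in> orbit \<sigma> w"
      then have "s \<noteq> u" "s \<noteq> v" using False eqs(1) self(1) by (metis UnCI)+
      then show "\<tau> s = \<sigma> s" by (rule \<tau>(3))
    qed
    then show ?thesis by simp
  qed
  then have "orbit_rel V \<sigma> \<subseteq> orbit_rel V \<tau>" by (auto simp: orbit_rel_def)
  moreover have "(u, v) \<in> orbit_rel V \<tau> - orbit_rel V \<sigma>"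
    using uv v_sub self(1)[of v] by (auto simp: orbit_rel_def)
  ultimately show "card (orbit_rel V \<sigma>) < card (orbit_rel V \<tau>)"
    by (intro psubset_card_mono orbit_rel_finite[OF permt fin]) blast
qed

lemma cycle_factor_orbit_list:
  assumes "cycle_factor V E \<sigma>" "finite V" "v \<in> V"
  obtains n where "n > 0" "(\<sigma> ^^ n) v = v"
    "hamiltonian_list (orbit \<sigma> v) E (map (\<lambda>i. (\<sigma> ^^ i) v) [0..<n])"
proof -
  have perm: "\<sigma> permutes V" using assms(1) by (simp add: cycle_factor_def)
  note self = orbit_self[OF perm assms(2)]
  let ?n = "funpow_dist1 \<sigma> v v"
  let ?L = "map (\<lambda>i. (\<sigma> ^^ i) v) [0..<?n]"
  have *: "(\<sigma> ^^ ?n) v = v" using funpow_dist1_prop[OF self[of v]] .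
  have inV: "(\<sigma> ^^ i) v \<in> V" for i
    using assms(3) permutes_in_image[OF perm] by (induction i) auto
  then have E: "E ((\<sigma> ^^ i) v) ((\<sigma> ^^ Suc i) v)" for i
    using assms(1) by (auto simp: cycle_factor_def)
  have "distinct ?L" using inj_on_funpow_dist1[OF self[of v]] by (simp add: distinct_map del: upt_Suc)
  moreover have "set ?L = orbit \<sigma> v" using orbit_conv_funpow_dist1[OF self[of v]] by (simp del: upt_Suc)
  moreover have "successively E (map (\<lambda>i. (\<sigma> ^^ i) v) [0..<m])" for m
  proof (induction m)
    case (Suc m)
    then show ?case using E[of "m - 1"]
      by (cases m) (auto simp: successively_append_iff last_map simp del: upt_Suc simp: upt_Suc_append)
  qed simp
  moreover have "E (last ?L) (hd ?L)"
    using E[of "?n - 1"] * by (auto simp: hd_map last_map simp del: upt_Suc)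
  ultimately show ?thesis
    using that[of ?n] * by (simp add: hamiltonian_list_def del: upt_Suc)
qed

text \<open>Strongness is phrased as a cut condition, the form in which the arguments use it. All
  assumptions are symmetric in \<open>X\<close> and \<open>Y\<close>, so a claim proved for vertices
  of \<open>X\<close> transfers to \<open>Y\<close> by interpreting the locale with the two sets
  exchanged.\<close>

locale bipartite_dominating =
  fixes X Y :: "'a set" and E :: "'a \<Rightarrow> 'a \<Rightarrow> bool" and a :: nat
  assumes a2: "a \<ge> 2"
    and finX: "finite X" and finY: "finite Y" and cardX: "card X = a" and cardY: "card Y = a"
    and disj: "X \<inter> Y = {}"
    and bip: "E u v \<Longrightarrow> u \<in> X \<and> v \<in> Y \<or> u \<in> Y \<and> v \<in> X"
    and strong: "S \<subseteq> X \<union> Y \<Longrightarrow> S \<noteq> {} \<Longrightarrow> S \<noteq> X \<union> Y \<Longrightarrow> \<exists>u\<in>S. \<exists>v\<in>X \<union> Y - S. E u v"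
    and dom: "E u z \<Longrightarrow> E v z \<Longrightarrow> u \<noteq> v \<Longrightarrow>
      2 * a - 2 \<le> degree E u \<and> a + 1 \<le> degree E v \<or> 2 * a - 2 \<le> degree E v \<and> a + 1 \<le> degree E u"
begin

abbreviation "V \<equiv> X \<union> Y"
abbreviation "deg \<equiv> degree E"

lemma swap: "bipartite_dominating Y X E a"
  using a2 finX finY cardX cardY disj bip strong dom
  by unfold_locales (auto simp: Un_commute[of Y X])

lemma finV: "finite V" using finX finY by simp

lemma bipX: "u \<in> X \<Longrightarrow> E u v \<Longrightarrow> v \<in> Y" "v \<in> X \<Longrightarrow> E u v \<Longrightarrow> u \<in> Y"
  and bipY: "u \<in> Y \<Longrightarrow> E u v \<Longrightarrow> v \<in> X" "v \<in> Y \<Longrightarrow> E u v \<Longrightarrow> u \<in> X"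
  using bip disj by blast+

lemma EV: "E u v \<Longrightarrow> u \<in> V \<and> v \<in> V" using bip by blast

lemma fin_nbs: "finite {w. E v w}" "finite {w. E w v}"
  using finV EV by (auto intro: finite_subset[of _ V])

lemma card_out_le: "card {w. E v w} \<le> a" and card_in_le: "card {w. E w v} \<le> a"
proof -
  have "{w. E v w} \<subseteq> Y \<or> {w. E v w} \<subseteq> X" "{w. E w v} \<subseteq> Y \<or> {w. E w v} \<subseteq> X"
    using bip disj by blast+
  then show "card {w. E v w} \<le> a" "card {w. E w v} \<le> a"
    using card_mono[OF finX] card_mono[OF finY] cardX cardY by metis+
qed

lemma out_arc: "v \<in> V \<Longrightarrow> \<exists>w. E v w"
  and in_arc: "v \<in> V \<Longrightarrow> \<exists>w. E w v"
proof -
  assume v: "v \<in> V"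
  have "card V = 2 * a" using card_Un_disjoint[OF finX finY disj] cardX cardY by simp
  then have "card {v} \<noteq> card V" using a2 by simp
  then have "{v} \<noteq> V" by metis
  then show "\<exists>w. E v w" using strong[of "{v}"] v by blast
  have "V - {v} \<noteq> {}" using \<open>{v} \<noteq> V\<close> v by blast
  then show "\<exists>w. E w v" using strong[of "V - {v}"] v by blast
qed

lemma out_full:
  assumes "card {w. E v w} = a"
  shows "v \<in> X \<Longrightarrow> {w. E v w} = Y" "v \<in> Y \<Longrightarrow> {w. E v w} = X"
proof -
  show "v \<in> X \<Longrightarrow> {w. E v w} = Y"
    by (rule card_subset_eq[OF finY]) (use assms cardY bipX in auto)
  show "v \<in> Y \<Longrightarrow> {w. E v w} = X"
    by (rule card_subset_eq[OF finX]) (use assms cardX bipY in auto)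
qed

lemma in_full:
  assumes "card {w. E w v} = a"
  shows "v \<in> X \<Longrightarrow> {w. E w v} = Y" "v \<in> Y \<Longrightarrow> {w. E w v} = X"
proof -
  show "v \<in> X \<Longrightarrow> {w. E w v} = Y"
    by (rule card_subset_eq[OF finY]) (use assms cardY bipX in auto)
  show "v \<in> Y \<Longrightarrow> {w. E w v} = X"
    by (rule card_subset_eq[OF finX]) (use assms cardX bipY in auto)
qed

end

locale maximal_factor = bipartite_dominating +
  fixes \<sigma> :: "'a \<Rightarrow> 'a"
  assumes factor: "cycle_factor (X \<union> Y) E \<sigma>"
    and maximal: "cycle_factor (X \<union> Y) E \<tau> \<Longrightarrow>
      card (orbit_rel (X \<union> Y) \<tau>) \<le> card (orbit_rel (X \<union> Y) \<sigma>)"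
    and not_ham: "\<not> hamiltonian_list (X \<union> Y) E vs"
begin

lemma swap_maximal: "maximal_factor Y X E a \<sigma>"
  unfolding maximal_factor_def maximal_factor_axioms_def
  using swap factor maximal not_ham by (simp add: Un_commute[of Y X])

lemma perm: "\<sigma> permutes V" and E_\<sigma>: "v \<in> V \<Longrightarrow> E v (\<sigma> v)"
  using factor by (auto simp: cycle_factor_def)

lemma \<sigma>_in: "\<sigma> v \<in> V \<longleftrightarrow> v \<in> V" using permutes_in_image[OF perm] .
lemma \<sigma>_X: "v \<in> X \<Longrightarrow> \<sigma> v \<in> Y" using E_\<sigma> bipX by blast
lemma \<sigma>_Y: "v \<in> Y \<Longrightarrow> \<sigma> v \<in> X" using E_\<sigma> bipY by blast
lemma \<sigma>_inj: "\<sigma> u = \<sigma> v \<longleftrightarrow> u = v" using permutes_inj[OF perm] by (auto dest: injD)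

lemma \<sigma>_pred: assumes "v \<in> V" obtains u where "u \<in> V" "\<sigma> u = v" "u \<in> X \<longleftrightarrow> v \<in> Y"
proof -
  obtain u where u: "\<sigma> u = v" using permutes_surj[OF perm] by (metis surjD)
  then have "u \<in> V" using \<sigma>_in assms by blast
  moreover have "u \<in> X \<longleftrightarrow> v \<in> Y" using u \<open>u \<in> V\<close> \<sigma>_X \<sigma>_Y disj by blast
  ultimately show ?thesis using that u by blast
qed

lemma orb_self: "v \<in> orbit \<sigma> v" using orbit_self[OF perm finV] .
lemma orb_eq: "w \<in> orbit \<sigma> v \<Longrightarrow> orbit \<sigma> w = orbit \<sigma> v" using orbit_eq_if_mem[OF perm finV] .
lemma orb_V: "v \<in> V \<Longrightarrow> orbit \<sigma> v \<subseteq> V" using permutes_orbit_subset[OF perm] .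
lemma orb_step: "\<sigma> v \<in> orbit \<sigma> u \<longleftrightarrow> v \<in> orbit \<sigma> u"
  using orb_eq orb_self orbit.base[of \<sigma> v] by metis

lemma no_exchange:
  assumes "u \<in> V" "v \<notin> orbit \<sigma> u" "E u (\<sigma> v)" "E v (\<sigma> u)"
  shows False
proof -
  have v: "v \<in> V" using assms(4) EV by blast
  let ?\<tau> = "\<sigma> \<circ> transpose u v"
  have "cycle_factor V E ?\<tau>"
    unfolding cycle_factor_def
  proof (intro conjI ballI)
    show "?\<tau> permutes V" using orbit_merge(1)[OF perm finV assms(1) v assms(2)] .
    fix w assume "w \<in> V"
    then show "E w (?\<tau> w)" using assms(3,4) E_\<sigma> by (cases "w = u"; cases "w = v") auto
  qed
  then have "card (orbit_rel V ?\<tau>) \<le> card (orbit_rel V \<sigma>)" by (rule maximal)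
  then show False using orbit_merge(2)[OF perm finV assms(1) v assms(2)] by simp
qed

lemma orbit_ne_V: "v \<in> V \<Longrightarrow> orbit \<sigma> v \<noteq> V"
  using cycle_factor_orbit_list[OF factor finV, of v] not_ham by metis

lemma arc_out_of_orbit: assumes "v \<in> V" obtains u w where "u \<in> orbit \<sigma> v" "w \<in> V - orbit \<sigma> v" "E u w"
  using strong[of "orbit \<sigma> v"] orb_V[OF assms] orbit_ne_V[OF assms] orb_self by blast

lemma arc_into_orbit: assumes "v \<in> V" obtains u w where "u \<in> V - orbit \<sigma> v" "w \<in> orbit \<sigma> v" "E u w"
proof -
  have "V - orbit \<sigma> v \<noteq> {}" using orb_V[OF assms] orbit_ne_V[OF assms] by blast
  moreover have "V - orbit \<sigma> v \<noteq> V" using orb_self[of v] assms by blast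
  moreover have "V - (V - orbit \<sigma> v) = orbit \<sigma> v" using orb_V[OF assms] by blast
  ultimately show ?thesis using strong[of "V - orbit \<sigma> v"] that by (metis Diff_subset)
qed

lemma card_orbit_halves: "card (Y \<inter> orbit \<sigma> v) = card (X \<inter> orbit \<sigma> v)"
proof -
  have "bij_betw \<sigma> (X \<inter> orbit \<sigma> v) (Y \<inter> orbit \<sigma> v)"
    unfolding bij_betw_def
  proof
    show "inj_on \<sigma> (X \<inter> orbit \<sigma> v)" using \<sigma>_inj by (auto simp: inj_on_def)
    show "\<sigma> ` (X \<inter> orbit \<sigma> v) = Y \<inter> orbit \<sigma> v"
    proof (intro equalityI subsetI)
      fix w assume w: "w \<in> Y \<inter> orbit \<sigma> v"
      then obtain u where "u \<in> V" "\<sigma> u = w" "u \<in> X \<longleftrightarrow> w \<in> Y" using \<sigma>_pred[of w] by blast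
      then show "w \<in> \<sigma> ` (X \<inter> orbit \<sigma> v)" using w orb_step by blast
    qed (use \<sigma>_X orb_step in auto)
  qed
  then show ?thesis using bij_betw_same_card by force
qed

text \<open>Both degrees in a dominating pair are at least \<open>a + 1\<close>, since
  \<open>a \<ge> 3\<close> gives \<open>2 * a - 2 \<ge> a + 1\<close>. So \<open>v\<close> shares no
  out-neighbour with another vertex; but an out-neighbour of \<open>v\<close> is also entered by its
  predecessor under \<open>\<sigma>\<close>, which must then be \<open>v\<close>.\<close>

lemma small_unique:
  assumes "a \<ge> 3" "v \<in> V" "deg v \<le> a"
  shows "E v w \<longleftrightarrow> w = \<sigma> v" "E u (\<sigma> v) \<longleftrightarrow> u = v"
proof -
  have *: "u = v" if "E v z" "E u z" for u z
    using dom[OF that] assms(1,3) by fastforce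
  have "w = \<sigma> v" if vw: "E v w"
  proof -
    obtain u where u: "u \<in> V" "\<sigma> u = w" using \<sigma>_pred EV[OF vw] by metis
    then show ?thesis using *[OF vw] E_\<sigma> by metis
  qed
  then show "E v w \<longleftrightarrow> w = \<sigma> v" using E_\<sigma> assms(2) by blast
  show "E u (\<sigma> v) \<longleftrightarrow> u = v" using * E_\<sigma> assms(2) by blast
qed

end

section \<open>Perfect matchings\<close>

lemma UNIV_hvert: "(UNIV :: hvert set) = {x1, x2, x3, y1, y2, y3}"
  by (auto intro: hvert.exhaust)

lemma verts_H2: "verts (H2 opt) = UNIV" and verts_H3: "verts H3 = UNIV"
  by (simp_all add: UNIV_hvert H2_def H3_def)

context bipartite_dominating begin

text \<open>By pigeonhole two vertices of \<open>S\<close> have a common out-neighbour, so some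
  \<open>b\<close> in \<open>S\<close> has degree at least \<open>2 * a - 2\<close>. As
  \<open>S = X\<close> would leave a vertex of \<open>Y\<close> without in-arcs, the neighbourhood
  \<open>N\<close> has at most \<open>a - 2\<close> elements; hence \<open>b\<close> needs all
  \<open>a\<close> in-arcs and every estimate is sharp. The two vertices of \<open>Y - N\<close> are
  entered only from the single vertex of \<open>X - S\<close>, so their degrees are at most
  \<open>a + 1\<close>, yet both dominate \<open>b\<close>. This forces
  \<open>a = 3\<close>.\<close>

lemma exists_H2_if_not_hall:
  assumes S: "S \<subseteq> X" and less: "card (\<Union>x\<in>S. {y. E x y}) < card S"
  shows "\<exists>opt. isomorphic_copy V E (H2 opt)"
proof -
  define N where "N = (\<Union>x\<in>S. {y. E x y})"
  have finS: "finite S" using S finX finite_subset by blast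
  have NY: "N \<subseteq> Y" using S bipX by (auto simp: N_def)
  then have finN: "finite N" using finY finite_subset by blast
  have outN: "{y. E x y} \<subseteq> N" if "x \<in> S" for x using that by (auto simp: N_def)
  have "\<exists>y. E x y" if "x \<in> S" for x using that S out_arc by blast
  then obtain f where f: "\<And>x. x \<in> S \<Longrightarrow> E x (f x)" by metis
  then have "f ` S \<subseteq> N" by (auto simp: N_def)
  then have "\<not> inj_on f S" using card_inj_on_le[of f S N] finN less unfolding N_def by linarith
  then obtain s t where st: "s \<in> S" "t \<in> S" "s \<noteq> t" "f s = f t" by (auto simp: inj_on_def)
  then have "E s (f s)" "E t (f s)" using f by metis+
  from dom[OF this st(3)] obtain b b' where b: "b \<in> S" "b' \<in> S" "b \<noteq> b'" "2 * a - 2 \<le> deg b" "a + 1 \<le> deg b'"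
    using st by metis
  have bX: "b \<in> X" "b' \<in> X" using b S by auto
  have out_b: "card {y. E b y} \<le> card N" using card_mono[OF finN outN[OF b(1)]] .
  have "S \<noteq> X"
  proof
    assume "S = X"
    then have "card N < card Y" using less cardX cardY by (simp add: N_def)
    then obtain y where "y \<in> Y" "y \<notin> N" using card_mono[OF finN] by (metis not_le subsetI)
    moreover from this obtain w where "E w y" using in_arc by blast
    ultimately show False using \<open>S = X\<close> bipY by (auto simp: N_def)
  qed
  then have "card S < a" using psubset_card_mono[OF finX] S cardX by blast
  moreover have "card N < card S" using less by (simp add: N_def)
  ultimately have cards: "card S = a - 1" "card N = a - 2" and in_b: "card {w. E w b} = a"
    using out_b b(4) card_in_le[of b] a2 unfolding degree_def by linarith+
  have "card (X - S) = 1" using cards(1) card_Diff_subset[OF finS S] cardX a2 by simp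
  then obtain x0 where x0: "X - S = {x0}" by (auto simp: card_1_singleton_iff)
  have "card (Y - N) = 2" using cards(2) card_Diff_subset[OF finN NY] cardY a2 by simp
  then obtain y y' where y: "Y - N = {y, y'}" "y \<noteq> y'" by (auto simp: card_2_iff)
  have in_y: "{w. E w z} \<subseteq> {x0}" if "z \<in> Y - N" for z
    using that x0 bipY by (auto simp: N_def)
  then have in1: "card {w. E w z} \<le> 1" if "z \<in> Y - N" for z
    using card_mono[of "{x0}"] that by fastforce
  have yY: "y \<in> Y" "y' \<in> Y" using y by auto
  have "N \<noteq> {}" using f[OF b(1)] b(1) by (auto simp: N_def)
  then have "card N > 0" using finN by (simp add: card_gt_0_iff)
  then have "a \<ge> 3" using cards(2) by linarith
  have "E y b" "E y' b" using in_full(1)[OF in_b bX(1)] yY by auto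
  from dom[OF this y(2)] have degy: "a + 1 \<le> deg y" "a + 1 \<le> deg y'" "2 * a - 2 \<le> deg y \<or> 2 * a - 2 \<le> deg y'"
    using \<open>a \<ge> 3\<close> by auto
  have degle: "deg z \<le> a + 1" if "z \<in> Y - N" for z
    using in1[OF that] card_out_le[of z] unfolding degree_def by simp
  have a3: "a = 3" using \<open>a \<ge> 3\<close> degy(3) degle[of y] degle[of y'] y a2 by auto
  obtain n where n: "N = {n}" using cards(2) a3 by (auto simp: card_1_singleton_iff)
  have "card S = 2" using cards(1) a3 by simp
  then have Seq: "S = {b, b'}" using b card_subset_eq[OF finS, of "{b, b'}"] by simp
  have Xeq: "X = {b, b', x0}" "x0 \<notin> S" and Yeq: "Y = {n, y, y'}" "n \<noteq> y" "n \<noteq> y'"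
    using x0 S Seq y NY n by auto
  have full_y: "card {w. E z w} = a \<and> E x0 z" if "z \<in> {y, y'}" for z
  proof -
    have z: "z \<in> Y - N" "a + 1 \<le> deg z" using that y degy by auto
    then have "card {w. E z w} = a" "card {w. E w z} = 1"
      using in1[OF z(1)] card_out_le[of z] unfolding degree_def by linarith+
    then show ?thesis using in_y[OF z(1)] by (auto simp: card_1_singleton_iff)
  qed
  then have yall: "{w. E y w} = X" "{w. E y' w} = X" using out_full(2) yY by auto
  have full_b: "{w. E w z} = Y \<and> E z n" if "z \<in> {b, b'}" for z
  proof -
    have z: "z \<in> S" "a + 1 \<le> deg z" using that b a3 by auto
    have "card {w. E z w} \<le> 1" using card_mono[OF finN outN[OF z(1)]] n by simp
    then have "card {w. E w z} = a" "card {w. E z w} = 1"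
      using card_in_le[of z] z(2) unfolding degree_def by linarith+
    then show ?thesis using in_full(1)[of z] outN[OF z(1)] n z S by (auto simp: card_1_singleton_iff)
  qed
  have out_b: "E z w \<longleftrightarrow> w = n" if "z \<in> {b, b'}" for z w
    using full_b[OF that] outN[of z] that n Seq by auto
  have in_y: "E w z \<longleftrightarrow> w = x0" if "z \<in> {y, y'}" for w z
    using in_y[of z] full_y[OF that] that y by auto
  \<comment> \<open>Without this arc nothing would leave \<open>{b, b', n}\<close>.\<close>
  have "E n x0"
  proof -
    have inV: "b \<in> X" "b' \<in> X" "x0 \<in> X" "n \<in> Y" unfolding Xeq(1) Yeq(1) by auto
    then have "x0 \<noteq> n" using disj by blast
    then have "x0 \<notin> {b, b', n}" using Xeq(2) Seq by blast
    then have "{b, b', n} \<subseteq> V" "{b, b', n} \<noteq> V" using inV by blast+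
    then obtain u v where uv: "u \<in> {b, b', n}" "v \<in> V - {b, b', n}" "E u v"
      using strong[of "{b, b', n}"] by blast
    then have "u = n" using out_b[of u v] by blast
    then have "v \<in> X" using bipY(1)[of n v] uv inV by blast
    then show ?thesis using uv \<open>u = n\<close> unfolding Xeq(1) by blast
  qed
  define g where "g h = (case h of x1 \<Rightarrow> b | x2 \<Rightarrow> b' | x3 \<Rightarrow> x0 | y1 \<Rightarrow> n | y2 \<Rightarrow> y | y3 \<Rightarrow> y')" for h
  have g: "g x1 = b" "g x2 = b'" "g x3 = x0" "g y1 = n" "g y2 = y" "g y3 = y'" by (auto simp: g_def)
  have nXX: "\<not> E p q" if "p \<in> X" "q \<in> X" for p q using that bipX disj by blast
  have nYY: "\<not> E p q" if "p \<in> Y" "q \<in> Y" for p q using that bipY disj by blast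
  have nE: "\<not> E p q" if "p \<in> {b, b', x0} \<and> q \<in> {b, b', x0} \<or> p \<in> {n, y, y'} \<and> q \<in> {n, y, y'}" for p q
    using that nXX nYY unfolding Xeq(1) Yeq(1) by blast
  have dist: "distinct [b, b', x0, n, y, y']"
  proof -
    have "z \<noteq> w" if "z \<in> X" "w \<in> Y" for z w using that disj by blast
    then have "\<forall>z\<in>{b, b', x0}. \<forall>w\<in>{n, y, y'}. z \<noteq> w" unfolding Xeq(1) Yeq(1) by blast
    moreover have "x0 \<noteq> b" "x0 \<noteq> b'" using Xeq(2) Seq by blast+
    ultimately show ?thesis using b(3) Yeq(2,3) y(2) by auto
  qed
  have pos: "E n b" "E n b'" "E y b" "E y b'" "E y x0" "E y' b" "E y' b'" "E y' x0" "E x0 y" "E x0 y'" "E n x0" "E b n" "E b' n"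
    using full_b[of b] full_b[of b'] yall full_y[of y] full_y[of y'] \<open>E n x0\<close> unfolding Xeq(1) Yeq(1) by auto
  have neg: "\<not> E b y" "\<not> E b y'" "\<not> E b' y" "\<not> E b' y'"
    using out_b Yeq(2,3) by auto
  have "bij_betw g UNIV V"
    unfolding bij_betw_def
  proof
    show "inj_on g UNIV"
    proof (rule inj_onI)
      fix h k assume "g h = g k" then show "h = k" using dist by (cases h; cases k) (auto simp: g)
    qed
    show "range g = V" unfolding UNIV_hvert Xeq(1) Yeq(1) by (auto simp: g)
  qed
  \<comment> \<open>The arc from \<open>x0\<close> to \<open>n\<close> is the only one left
    undetermined; its presence is the flag of \<open>H2\<close>.\<close>
  moreover have "(h, k) \<in> arcs (H2 (E x0 n)) \<longleftrightarrow> E (g h) (g k)" for h k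
    using pos neg nE by (cases h; cases k) (auto simp: g H2_def both_ways_def)
  ultimately have "isomorphic_copy V E (H2 (E x0 n))"
    unfolding isomorphic_copy_def verts_H2 by blast
  then show ?thesis ..
qed

lemma exists_H2_or_matching:
  "(\<exists>opt. isomorphic_copy V E (H2 opt)) \<or> (\<exists>f. bij_betw f X Y \<and> (\<forall>x\<in>X. E x (f x)))"
proof (cases "\<exists>S\<subseteq>X. card (\<Union>x\<in>S. {y. E x y}) < card S")
  case True
  then show ?thesis using exists_H2_if_not_hall by blast
next
  case False
  then obtain f where f: "inj_on f X" "\<forall>x\<in>X. f x \<in> {y. E x y}"
    using hall_marriage[OF finX, of "\<lambda>x. {y. E x y}"] fin_nbs by (auto simp: not_less)
  have "f ` X = Y"
    by (rule card_subset_eq[OF finY]) (use f bipX card_image[OF f(1)] cardX cardY in auto)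
  then show ?thesis using f by (auto simp: bij_betw_def)
qed

text \<open>A perfect matching from \<open>X\<close> into \<open>Y\<close> and one from
  \<open>Y\<close> into \<open>X\<close> combine to a permutation along arcs. The second comes from
  the exchanged locale, whose exceptional outcome is again \<open>H2\<close> because a copy need not
  respect the sides.\<close>

lemma exists_H2_or_factor:
  "(\<exists>opt. isomorphic_copy V E (H2 opt)) \<or> (\<exists>\<sigma>. cycle_factor V E \<sigma>)"
proof -
  interpret sw: bipartite_dominating Y X E a by (rule swap)
  show ?thesis
  proof (cases "\<exists>opt. isomorphic_copy V E (H2 opt)")
    case False
    then obtain f g where f: "bij_betw f X Y" "\<forall>x\<in>X. E x (f x)" and g: "bij_betw g Y X" "\<forall>y\<in>Y. E y (g y)"
      using exists_H2_or_matching sw.exists_H2_or_matching by (auto simp: Un_commute[of Y X])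
    define \<sigma> where "\<sigma> v = (if v \<in> X then f v else if v \<in> Y then g v else v)" for v
    have "bij_betw \<sigma> X Y" "bij_betw \<sigma> Y X"
      using f(1) g(1) disj by (auto simp: \<sigma>_def cong: bij_betw_cong intro!: bij_betw_cong[THEN iffD1, OF _ f(1)] bij_betw_cong[THEN iffD1, OF _ g(1)])
    then have "bij_betw \<sigma> V V"
      using bij_betw_combine[of \<sigma> X Y Y X] disj by (simp add: Un_commute Int_commute)
    then have "\<sigma> permutes V"
      by (rule bij_imp_permutes) (auto simp: \<sigma>_def)
    then have "cycle_factor V E \<sigma>" using f(2) g(2) by (auto simp: cycle_factor_def \<sigma>_def)
    then show ?thesis by blast
  qed simp
qed

lemma maximal_factor_exists:
  assumes "cycle_factor V E \<sigma>\<^sub>0" "\<And>vs. \<not> hamiltonian_list V E vs"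
  obtains \<sigma> where "maximal_factor X Y E a \<sigma>"
proof -
  have "card (orbit_rel V \<tau>) < Suc (card (V \<times> V))" if "cycle_factor V E \<tau>" for \<tau>
    using that card_mono[OF _ orbit_rel_finite(1)[of \<tau> V]] finV
    by (simp add: cycle_factor_def less_Suc_eq_le)
  then obtain \<sigma> where "cycle_factor V E \<sigma>"
      "\<forall>\<tau>. cycle_factor V E \<tau> \<longrightarrow> card (orbit_rel V \<tau>) \<le> card (orbit_rel V \<sigma>)"
    using ex_has_greatest_nat[of "cycle_factor V E" \<sigma>\<^sub>0 "\<lambda>\<tau>. card (orbit_rel V \<tau>)"] assms(1) by metis
  then have "maximal_factor X Y E a \<sigma>"
    using assms(2) by unfold_locales auto
  then show ?thesis using that by blast
qed

end

section \<open>Degrees along the cycles of a maximal factor\<close>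

context bipartite_dominating begin

text \<open>Of the \<open>2 * a\<close> conceivable arcs at \<open>v\<close>, those from
  \<open>P\<close> and those to \<open>Q\<close> are missing.\<close>

lemma degree_misses:
  assumes "v \<in> V" "P \<union> Q \<subseteq> V" "\<And>p. p \<in> P \<union> Q \<Longrightarrow> p \<in> X \<longleftrightarrow> v \<notin> X"
    and "\<And>p. p \<in> P \<Longrightarrow> \<not> E p v" "\<And>q. q \<in> Q \<Longrightarrow> \<not> E v q"
  shows "card P + card Q + deg v \<le> 2 * a"
proof -
  define S where "S = (if v \<in> X then Y else X)"
  have S: "finite S" "card S = a" using finX finY cardX cardY by (auto simp: S_def)
  have "P \<subseteq> S" "Q \<subseteq> S" "{w. E v w} \<subseteq> S" "{w. E w v} \<subseteq> S"
  proof -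
    have "z \<in> S" if "z \<in> V" "z \<in> X \<longleftrightarrow> v \<notin> X" for z
      using that by (auto simp: S_def)
    then show "P \<subseteq> S" "Q \<subseteq> S" using assms(2,3) by blast+
    have "z \<in> S" if "E v z \<or> E z v" for z
      using that bip[of v z] bip[of z v] disj by (auto simp: S_def)
    then show "{w. E v w} \<subseteq> S" "{w. E w v} \<subseteq> S" by blast+
  qed
  moreover have "P \<inter> {w. E w v} = {}" "Q \<inter> {w. E v w} = {}" using assms by auto
  moreover have "card A + card B \<le> card S" if "A \<subseteq> S" "B \<subseteq> S" "A \<inter> B = {}" for A B
  proof -
    have "card A + card B = card (A \<union> B)"
      using that finite_subset[OF _ S(1)] by (intro card_Un_disjoint[symmetric]) auto
    also have "\<dots> \<le> card S" using that by (intro card_mono S(1)) auto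
    finally show ?thesis .
  qed
  ultimately have "card P + card {w. E w v} \<le> card S" "card Q + card {w. E v w} \<le> card S"
    by blast+
  then show ?thesis using S(2) by (simp add: degree_def)
qed

lemma degree_restrict:
  "deg v = card {w\<in>C. E v w} + card {w\<in>C. E w v} + (card {w. w \<notin> C \<and> E v w} + card {w. w \<notin> C \<and> E w v})"
proof -
  have "card {w. P w} = card {w\<in>C. P w} + card {w. w \<notin> C \<and> P w}" if "finite {w. P w}" for P
  proof -
    have "{w. P w} = {w\<in>C. P w} \<union> {w. w \<notin> C \<and> P w}" by blast
    also have "card \<dots> = card {w\<in>C. P w} + card {w. w \<notin> C \<and> P w}"
      by (rule card_Un_disjoint) (use that in \<open>auto elim: finite_subset[rotated]\<close>)
    finally show ?thesis .
  qed
  from this[OF fin_nbs(1)] this[OF fin_nbs(2)] show ?thesis by (simp add: degree_def)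
qed

end

context maximal_factor begin

section \<open>Exclusion of vertices of degree at most \<open>a\<close>\<close>

lemma two_cycle_orbit: assumes "\<sigma> (\<sigma> v) = v" shows "orbit \<sigma> v = {v, \<sigma> v}"
proof
  show "orbit \<sigma> v \<subseteq> {v, \<sigma> v}" by (rule orbit_closed_subset) (use assms in auto)
  show "{v, \<sigma> v} \<subseteq> orbit \<sigma> v" using orb_self orb_step by auto
qed

lemma full_out_arc:
  assumes "card {z. E w z} = a" "E w v" "E u v"
  shows "E w (\<sigma> u)"
proof (cases "w \<in> X")
  case True
  then have "u \<in> X" using assms bipX(1)[of w v] bipY(2)[of v u] by blast
  then show ?thesis using out_full(1)[OF assms(1) True] \<sigma>_X by blast
next
  case False
  then have w: "w \<in> Y" using EV assms(2) by blast
  then have "u \<in> Y" using assms bipY(1)[of w v] bipX(2)[of v u] by blast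
  then show ?thesis using out_full(2)[OF assms(1) w] \<sigma>_Y by blast
qed

text \<open>If \<open>deg v \<le> a\<close>, then \<open>\<sigma> v\<close> is entered only by
  \<open>v\<close>, so an arc into the 2-cycle from outside must be some
  \<open>u \<rightarrow> v\<close>. If \<open>\<sigma> v\<close> also had small degree, it would be
  the only in-neighbour of \<open>v\<close>. Otherwise its in-degree 1 forces full out-degree, so it
  reaches \<open>\<sigma> u\<close>, and \<open>u\<close> and \<open>\<sigma> v\<close> can exchange
  successors.\<close>

lemma two_cycle_not_small:
  assumes "a \<ge> 3" "v \<in> V" "\<sigma> (\<sigma> v) = v"
  shows "a + 1 \<le> deg v"
proof (rule ccontr)
  assume "\<not> ?thesis"
  then have v: "deg v \<le> a" by simp
  have w: "\<sigma> v \<in> V" using assms(2) \<sigma>_in by blast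
  note orb = two_cycle_orbit[OF assms(3)]
  note unv = small_unique[OF assms(1,2) v]
  obtain u z where uz: "u \<in> V - orbit \<sigma> v" "z \<in> orbit \<sigma> v" "E u z"
    using arc_into_orbit[OF assms(2)] by metis
  have "z \<noteq> \<sigma> v" using unv(2) uz(1,3) orb by blast
  then have "z = v" using uz(2) unfolding orb by blast
  then have "E u v" using uz(3) by simp
  show False
  proof (cases "deg (\<sigma> v) \<le> a")
    case True
    then have "u = \<sigma> v" using small_unique(2)[OF assms(1) w] \<open>E u v\<close> assms(3) by simp
    then show False using uz(1) orb by blast
  next
    case False
    have "{u. E u (\<sigma> v)} = {v}" using unv(2) by blast
    then have "card {z. E (\<sigma> v) z} = a" using False card_out_le[of "\<sigma> v"] by (simp add: degree_def)
    then have "E (\<sigma> v) (\<sigma> u)" using full_out_arc[OF _ _ \<open>E u v\<close>] E_\<sigma>[OF w] assms(3) by simp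
    moreover have "u \<notin> orbit \<sigma> (\<sigma> v)" using uz(1) orb_eq[of "\<sigma> v" v] orb by auto
    ultimately show False using no_exchange[OF w] \<open>E u v\<close> assms(3) by metis
  qed
qed

text \<open>Write \<open>w = \<sigma> v\<close>. Its in-degree is 1, so it dominates all of
  \<open>X\<close> and has degree exactly \<open>a + 1 < 2 * a - 2\<close>; every other vertex of
  \<open>Y\<close> shares an out-neighbour with \<open>w\<close> and hence misses at most two arcs.
  Vertices of \<open>Y\<close> on other cycles already miss the arc from \<open>v\<close> and the
  arc to \<open>x = \<sigma> w\<close>, the latter by exchange with \<open>w\<close>. So
  \<open>y'\<close> and \<open>y''\<close> have all their other arcs, and exchanging along these
  excludes both arcs between \<open>x'\<close> and \<open>y\<close>. With the arc from
  \<open>v\<close>, this makes three missing arcs at \<open>y\<close>.\<close>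

lemma no_small_aux:
  assumes a4: "a \<ge> 4" and v: "v \<in> X" "deg v \<le> a" and w: "a + 1 \<le> deg (\<sigma> v)"
  shows False
proof -
  let ?w = "\<sigma> v"
  have a3: "a \<ge> 3" and vV: "v \<in> V" using a4 v by auto
  have wY: "?w \<in> Y" using \<sigma>_X v by blast
  note unv = small_unique[OF a3 vV v(2)]
  have "{u. E u ?w} = {v}" using unv(2) by blast
  then have full: "card {z. E ?w z} = a" and degw: "deg ?w = a + 1"
    using w card_out_le[of ?w] by (simp_all add: degree_def)
  then have E_w: "E ?w z" if "z \<in> X" for z using out_full(2)[OF full wY] that by blast
  have big: "2 * a - 2 \<le> deg u" if "u \<in> Y" "u \<noteq> ?w" for u
  proof -
    have "E u (\<sigma> u)" "E ?w (\<sigma> u)" using E_\<sigma> that E_w \<sigma>_Y by blast+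
    from dom[OF this that(2)] show ?thesis using degw a4 by linarith
  qed
  define x where "x = \<sigma> ?w"
  have x: "x \<in> X" "x \<noteq> v"
    using two_cycle_not_small[OF a3 vV] v(2) \<sigma>_Y[OF wY] by (auto simp: x_def)
  define y where "y = \<sigma> x"
  have y: "y \<in> Y" "y \<noteq> ?w" using \<sigma>_X x \<sigma>_inj by (auto simp: y_def)
  obtain x' where x': "x' \<in> X" "x' \<notin> orbit \<sigma> v"
  proof -
    obtain p where p: "p \<in> V" "p \<notin> orbit \<sigma> v" using orb_V[OF vV] orbit_ne_V[OF vV] by blast
    then show ?thesis using that[of p] that[of "\<sigma> p"] \<sigma>_Y orb_step by blast
  qed
  define y' where "y' = \<sigma> x'"
  have y': "y' \<in> Y" "y' \<notin> orbit \<sigma> v" using x' \<sigma>_X orb_step by (auto simp: y'_def)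
  obtain y'' where y'': "y'' \<in> Y" "\<sigma> y'' = x'" "y'' \<notin> orbit \<sigma> v"
    using \<sigma>_pred[of x'] x' disj orb_step by (metis UnE UnI1 disjoint_iff)
  have orbs: "?w \<in> orbit \<sigma> v" "x \<in> orbit \<sigma> v" "y \<in> orbit \<sigma> v"
    using orb_self orb_step by (simp_all add: x_def y_def)
  then have orb: "orbit \<sigma> ?w = orbit \<sigma> v" "orbit \<sigma> x = orbit \<sigma> v" "orbit \<sigma> y = orbit \<sigma> v"
    using orb_eq by blast+
  have outside: "\<not> E z x" "\<not> E v z" "2 * a - 2 \<le> deg z" if z: "z \<in> Y" "z \<notin> orbit \<sigma> v" for z
  proof -
    have zw: "z \<noteq> ?w" using z orbs by blast
    show "\<not> E v z" using unv(1) zw by blast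
    show "2 * a - 2 \<le> deg z" using big z zw by blast
    show "\<not> E z x"
      using no_exchange[of ?w z] wY z orb E_w[OF \<sigma>_Y[OF z(1)]] by (auto simp: x_def)
  qed
  have YX: "z \<in> Y \<Longrightarrow> z \<notin> X" for z using disj by blast
  have "E x y'"
  proof (rule ccontr)
    assume "\<not> E x y'"
    then have "card {v, x} + card {x} + deg y' \<le> 2 * a"
      using outside[OF y'] y' x v YX by (intro degree_misses) auto
    then show False using outside(3)[OF y'] x(2) a4 by simp
  qed
  then have "\<not> E x' y"
    using no_exchange[of x x'] x x' orb by (auto simp: y_def y'_def)
  have "E y'' (\<sigma> y)"
  proof (rule ccontr)
    assume n: "\<not> E y'' (\<sigma> y)"
    have ne: "x \<noteq> \<sigma> y" using y(2) \<sigma>_inj by (auto simp: x_def)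
    have "card {v} + card {x, \<sigma> y} + deg y'' \<le> 2 * a"
      using outside[OF y''(1,3)] y'' y x v YX n \<sigma>_Y by (intro degree_misses) auto
    then show False using outside(3)[OF y''(1,3)] ne a4 by simp
  qed
  then have "\<not> E y x'"
    using no_exchange[of y y''] y y'' orb by auto
  moreover have "\<not> E v y" using unv(1) y(2) by blast
  ultimately have "card {v, x'} + card {x'} + deg y \<le> 2 * a"
    using \<open>\<not> E x' y\<close> x' y v YX by (intro degree_misses) auto
  moreover have "v \<noteq> x'" using x' orb_self by blast
  ultimately show False using big[OF y] a4 by simp
qed

text \<open>By the preceding lemma on both sides, low degree passes to the successor and so around
  the whole cycle. Then each vertex of the cycle is entered only by its predecessor, and no arc can
  come in from outside.\<close>

lemma no_small:
  assumes "a \<ge> 4" "v \<in> V"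
  shows "a + 1 \<le> deg v"
proof (rule ccontr)
  assume v: "\<not> ?thesis"
  have a3: "a \<ge> 3" using assms by simp
  interpret sw: maximal_factor Y X E a \<sigma> by (rule swap_maximal)
  have step: "deg (\<sigma> u) \<le> a" if "u \<in> V" "deg u \<le> a" for u
  proof (rule ccontr)
    assume "\<not> ?thesis"
    then show False using no_small_aux[of u] sw.no_small_aux[of u] that assms(1) by auto
  qed
  have "orbit \<sigma> v \<subseteq> {u\<in>V. deg u \<le> a}"
    by (rule orbit_closed_subset) (use step v assms \<sigma>_in in auto)
  moreover obtain u w where "u \<in> V - orbit \<sigma> v" "w \<in> orbit \<sigma> v" "E u w"
    using arc_into_orbit[OF assms(2)] by metis
  moreover from this obtain w' where "\<sigma> w' = w" "w' \<in> orbit \<sigma> v"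
    using \<sigma>_pred[of w] orb_step EV by metis
  ultimately show False using small_unique(2)[OF a3, of w' u] by auto
qed

section \<open>Counting the arcs between a cycle and the rest\<close>

lemma cross_X:
  assumes u: "u \<in> X"
  defines "C \<equiv> orbit \<sigma> u"
  shows "card {w. w \<notin> C \<and> E u w} + card {w. w \<notin> C \<and> E w (\<sigma> u)} \<le> a - card (X \<inter> C)" (is ?le)
    and "card {w. w \<notin> C \<and> E u w} + card {w. w \<notin> C \<and> E w (\<sigma> u)} = a - card (X \<inter> C) \<Longrightarrow>
      p \<in> X - C \<Longrightarrow> E u (\<sigma> p) \<or> E p (\<sigma> u)"
proof -
  \<comment> \<open>For \<open>p\<close> off the cycle, \<open>u \<rightarrow> \<sigma> p\<close>
    and \<open>p \<rightarrow> \<sigma> u\<close> exclude each other by \<open>no_exchange\<close>.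
    Indexing the first kind of arc by \<open>p\<close> instead of its head turns both kinds into
    disjoint subsets of \<open>X - C\<close>.\<close>
  define A B where "A = {p\<in>X - C. E u (\<sigma> p)}" and "B = {p\<in>X - C. E p (\<sigma> u)}"
  have fin: "finite A" "finite B" "finite (X - C)" using finX by (auto simp: A_def B_def)
  have "{w. w \<notin> C \<and> E u w} = \<sigma> ` A"
  proof (intro equalityI subsetI)
    fix w assume w: "w \<in> {w. w \<notin> C \<and> E u w}"
    then have "w \<in> Y" using bipX(1)[OF u] by blast
    then obtain p where "p \<in> V" "\<sigma> p = w" "p \<in> X" using \<sigma>_pred[of w] by blast
    then show "w \<in> \<sigma> ` A" using w orb_step by (auto simp: A_def C_def)
  qed (use orb_step in \<open>auto simp: A_def C_def\<close>)
  then have cA: "card {w. w \<notin> C \<and> E u w} = card A"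
    using \<sigma>_inj by (auto intro!: card_image simp: inj_on_def)
  have cB: "{w. w \<notin> C \<and> E w (\<sigma> u)} = B"
    using bipY(2)[OF \<sigma>_X[OF u]] by (auto simp: B_def)
  have dis: "A \<inter> B = {}"
    using no_exchange[of u] u by (auto simp: A_def B_def C_def)
  have sub: "A \<union> B \<subseteq> X - C" by (auto simp: A_def B_def)
  have cX: "card (X - C) = a - card (X \<inter> C)"
    using card_Diff_subset_Int[of X C] finX cardX by (simp add: finite_Int)
  have cAB: "card (A \<union> B) = card A + card B" using fin dis by (intro card_Un_disjoint)
  show ?le using card_mono[OF fin(3) sub] unfolding cA cB cX cAB .
  assume "card {w. w \<notin> C \<and> E u w} + card {w. w \<notin> C \<and> E w (\<sigma> u)} = a - card (X \<inter> C)" "p \<in> X - C"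
  then have "p \<in> A \<union> B" using card_subset_eq[OF fin(3) sub] cA cB cX cAB by simp
  then show "E u (\<sigma> p) \<or> E p (\<sigma> u)" by (auto simp: A_def B_def)
qed

lemma cross:
  assumes u: "u \<in> V"
  defines "C \<equiv> orbit \<sigma> u"
  shows "card {w. w \<notin> C \<and> E u w} + card {w. w \<notin> C \<and> E w (\<sigma> u)} \<le> a - card (X \<inter> C)" (is ?le)
    and "card {w. w \<notin> C \<and> E u w} + card {w. w \<notin> C \<and> E w (\<sigma> u)} = a - card (X \<inter> C) \<Longrightarrow>
      p \<in> V - C \<Longrightarrow> p \<in> X \<longleftrightarrow> u \<in> X \<Longrightarrow> E u (\<sigma> p) \<or> E p (\<sigma> u)"
proof -
  interpret sw: maximal_factor Y X E a \<sigma> by (rule swap_maximal)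
  show ?le
    using cross_X(1)[of u] sw.cross_X(1)[of u] u card_orbit_halves[of u] unfolding C_def by auto
  show "card {w. w \<notin> C \<and> E u w} + card {w. w \<notin> C \<and> E w (\<sigma> u)} = a - card (X \<inter> C) \<Longrightarrow>
      p \<in> V - C \<Longrightarrow> p \<in> X \<longleftrightarrow> u \<in> X \<Longrightarrow> E u (\<sigma> p) \<or> E p (\<sigma> u)"
    using cross_X(2)[of u p] sw.cross_X(2)[of u p] u card_orbit_halves[of u] unfolding C_def by auto
qed

lemma card_orbit: "v \<in> V \<Longrightarrow> card (orbit \<sigma> v) = 2 * card (X \<inter> orbit \<sigma> v)"
proof -
  assume "v \<in> V"
  then have "orbit \<sigma> v = (X \<inter> orbit \<sigma> v) \<union> (Y \<inter> orbit \<sigma> v)" using orb_V by blast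
  also have "card \<dots> = card (X \<inter> orbit \<sigma> v) + card (Y \<inter> orbit \<sigma> v)"
    using finX finY disj by (intro card_Un_disjoint) auto
  finally show ?thesis using card_orbit_halves[of v] by simp
qed

definition inner_degree :: "'a set \<Rightarrow> 'a \<Rightarrow> nat" where
  "inner_degree C w = card {z\<in>C. E w z} + card {z\<in>C. E z w}"

text \<open>Shifting the in-arcs along \<open>\<sigma>\<close> groups the out-arcs of
  \<open>u\<close> with the in-arcs of \<open>\<sigma> u\<close>, the combination bounded by
  \<open>cross\<close>. Equality of the sums forces equality at every single
  \<open>u\<close>.\<close>

lemma orbit_degree_sum:
  assumes v: "v \<in> V"
  defines "C \<equiv> orbit \<sigma> v"
  shows "(\<Sum>w\<in>C. deg w) \<le> (\<Sum>w\<in>C. inner_degree C w) + 2 * card (X \<inter> C) * (a - card (X \<inter> C))" (is ?le)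
    and "(\<Sum>w\<in>C. deg w) = (\<Sum>w\<in>C. inner_degree C w) + 2 * card (X \<inter> C) * (a - card (X \<inter> C)) \<Longrightarrow>
      u \<in> C \<Longrightarrow> p \<in> V - C \<Longrightarrow> p \<in> X \<longleftrightarrow> u \<in> X \<Longrightarrow> E u (\<sigma> p) \<or> E p (\<sigma> u)"
proof -
  define c where "c = card (X \<inter> C)"
  define g where "g u = card {w. w \<notin> C \<and> E u w} + card {w. w \<notin> C \<and> E w (\<sigma> u)}" for u
  have CV: "C \<subseteq> V" using orb_V[OF v] by (simp add: C_def)
  have finC: "finite C" using CV finV finite_subset by blast
  have eqC: "orbit \<sigma> u = C" if "u \<in> C" for u using that orb_eq by (simp add: C_def)
  have gle: "g u \<le> a - c" if "u \<in> C" for u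
    using cross(1)[of u] that CV eqC[OF that] unfolding g_def c_def by auto
  have bij: "bij_betw \<sigma> C C"
  proof (rule bij_betw_imageI)
    show "inj_on \<sigma> C" using \<sigma>_inj by (auto simp: inj_on_def)
    show "\<sigma> ` C = C"
    proof (intro equalityI subsetI)
      fix w assume w: "w \<in> C"
      then obtain u where "\<sigma> u = w" using \<sigma>_pred CV by blast
      then show "w \<in> \<sigma> ` C" using w orb_step unfolding C_def by blast
    qed (use orb_step in \<open>auto simp: C_def\<close>)
  qed
  have "(\<Sum>w\<in>C. card {z. z \<notin> C \<and> E z w}) = (\<Sum>w\<in>C. card {z. z \<notin> C \<and> E z (\<sigma> w)})"
    by (rule sum.reindex_bij_betw[OF bij, symmetric])
  then have eq: "(\<Sum>w\<in>C. deg w) = (\<Sum>w\<in>C. inner_degree C w) + (\<Sum>w\<in>C. g w)"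
    by (simp add: degree_restrict[of _ C] inner_degree_def g_def sum.distrib)
  have cardC: "card C = 2 * c" using card_orbit[OF v] by (simp add: C_def c_def)
  have const: "(\<Sum>w\<in>C. a - c) = 2 * c * (a - c)" by (simp add: cardC)
  have "(\<Sum>w\<in>C. g w) \<le> 2 * c * (a - c)" unfolding const[symmetric] by (rule sum_mono) (rule gle)
  then show ?le using eq by (simp add: c_def)
  assume "(\<Sum>w\<in>C. deg w) = (\<Sum>w\<in>C. inner_degree C w) + 2 * card (X \<inter> C) * (a - card (X \<inter> C))"
    and u: "u \<in> C" "p \<in> V - C" "p \<in> X \<longleftrightarrow> u \<in> X"
  then have sum_eq: "(\<Sum>w\<in>C. g w) = (\<Sum>w\<in>C. a - c)" unfolding const using eq by (simp add: c_def)
  have "g u = a - c"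
  proof (rule ccontr)
    assume "g u \<noteq> a - c"
    then have "g u < a - c" using gle[OF u(1)] by simp
    then have "(\<Sum>w\<in>C. g w) < (\<Sum>w\<in>C. a - c)" using sum_strict_mono_ex1[OF finC] gle u(1) by metis
    then show False using sum_eq by simp
  qed
  then show "E u (\<sigma> p) \<or> E p (\<sigma> u)"
    using cross(2)[of u p] u CV eqC[OF u(1)] unfolding g_def c_def by auto
qed

text \<open>A 2-cycle has inner degree sum 4, so its two degrees add up to at most
  \<open>4 + 2 * (a - 1) = 2 * (a + 1)\<close>, while each is at least \<open>a + 1\<close> by
  \<open>two_cycle_not_small\<close>. Hence equality holds throughout; \<open>no_exchange\<close>
  supplies the other half of the equivalence.\<close>

lemma two_cycle_tight:
  assumes a3: "a \<ge> 3" and v: "v \<in> V" "\<sigma> (\<sigma> v) = v"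
  shows "deg v = a + 1"
    and "p \<in> V \<Longrightarrow> p \<notin> {v, \<sigma> v} \<Longrightarrow> p \<in> X \<longleftrightarrow> v \<in> X \<Longrightarrow> E v (\<sigma> p) \<longleftrightarrow> \<not> E p (\<sigma> v)"
proof -
  let ?w = "\<sigma> v"
  have w: "?w \<in> V" "\<sigma> (\<sigma> ?w) = ?w" using v \<sigma>_in by auto
  have orb: "orbit \<sigma> v = {v, ?w}" by (rule two_cycle_orbit[OF v(2)])
  have vw: "v \<noteq> ?w" using E_\<sigma>[OF v(1)] bip[of v ?w] disj by auto
  have noloop: "\<not> E z z" for z using bip[of z z] disj by blast
  have arcs: "E v ?w" "E ?w v" using E_\<sigma> v w(1) by metis+
  have "{z \<in> {v, ?w}. E v z} = {?w}" "{z \<in> {v, ?w}. E z v} = {?w}"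
    "{z \<in> {v, ?w}. E ?w z} = {v}" "{z \<in> {v, ?w}. E z ?w} = {v}"
    using arcs noloop by auto
  then have "(\<Sum>z\<in>orbit \<sigma> v. inner_degree (orbit \<sigma> v) z) = 4"
    using vw unfolding orb inner_degree_def by simp
  moreover have "card (X \<inter> orbit \<sigma> v) = 1" using card_orbit[OF v(1)] vw unfolding orb by simp
  moreover have "(\<Sum>z\<in>orbit \<sigma> v. deg z) = deg v + deg ?w" using vw unfolding orb by simp
  moreover have "a + 1 \<le> deg v" "a + 1 \<le> deg ?w"
    using two_cycle_not_small[OF a3] v w by auto
  moreover note orbit_degree_sum[OF v(1)]
  ultimately have s: "deg v + deg ?w \<le> 4 + 2 * (a - 1)"
      "\<And>p. deg v + deg ?w = 4 + 2 * (a - 1) \<Longrightarrow> p \<in> V - orbit \<sigma> v \<Longrightarrow> p \<in> X \<longleftrightarrow> v \<in> X \<Longrightarrow> E v (\<sigma> p) \<or> E p ?w"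
      and ge: "a + 1 \<le> deg v" "a + 1 \<le> deg ?w"
    using orb_self[of v] by auto
  show "deg v = a + 1" using s(1) ge a3 by linarith
  assume p: "p \<in> V" "p \<notin> {v, \<sigma> v}" "p \<in> X \<longleftrightarrow> v \<in> X"
  have "deg v + deg ?w = 4 + 2 * (a - 1)" using s(1) ge a3 by linarith
  then have "E v (\<sigma> p) \<or> E p ?w" using s(2)[of p] p orb by blast
  then show "E v (\<sigma> p) \<longleftrightarrow> \<not> E p (\<sigma> v)" using no_exchange[of v p] v p orb by blast
qed

end

section \<open>Cycles of length two\<close>

context bipartite_dominating begin

lemma misses_big:
  assumes "2 * a - 2 \<le> deg v" "v \<in> V" "P \<union> Q \<subseteq> V" "\<And>p. p \<in> P \<union> Q \<Longrightarrow> p \<in> X \<longleftrightarrow> v \<notin> X"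
    and "\<And>p. p \<in> P \<Longrightarrow> \<not> E p v" "\<And>q. q \<in> Q \<Longrightarrow> \<not> E v q"
  shows "card P + card Q \<le> 2"
  using degree_misses[OF assms(2-6)] assms(1) by simp

lemma restricted_nbs_le:
  assumes "card (X \<inter> C) \<le> c" "card (Y \<inter> C) \<le> c"
  shows "card {z\<in>C. E w z} \<le> c" "card {z\<in>C. E z w} \<le> c"
proof -
  have "{z\<in>C. E w z} \<subseteq> X \<inter> C \<or> {z\<in>C. E w z} \<subseteq> Y \<inter> C"
    "{z\<in>C. E z w} \<subseteq> X \<inter> C \<or> {z\<in>C. E z w} \<subseteq> Y \<inter> C"
    using bip disj by blast+
  then show "card {z\<in>C. E w z} \<le> c" "card {z\<in>C. E z w} \<le> c"
    using card_mono[of "X \<inter> C"] card_mono[of "Y \<inter> C"] finX finY assms by (meson finite_Int le_trans)+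
qed

end

context maximal_factor begin

lemma orbit_half_pos: "v \<in> V \<Longrightarrow> card (X \<inter> orbit \<sigma> v) \<ge> 1"
proof -
  assume v: "v \<in> V"
  have "finite (orbit \<sigma> v)" using orb_V[OF v] finV finite_subset by blast
  then have "card (orbit \<sigma> v) > 0" using orb_self[of v] by (auto simp: card_gt_0_iff)
  then show ?thesis using card_orbit[OF v] by simp
qed

lemma disjoint_orbits_half:
  assumes "v \<in> V" "w \<in> V" "w \<notin> orbit \<sigma> v"
  shows "card (X \<inter> orbit \<sigma> v) + card (X \<inter> orbit \<sigma> w) + card (X - orbit \<sigma> v - orbit \<sigma> w) = a"
proof -
  have dis: "orbit \<sigma> v \<inter> orbit \<sigma> w = {}"
    using orb_eq assms(3) orb_self by (metis disjoint_iff)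
  have "X = (X \<inter> orbit \<sigma> v) \<union> (X \<inter> orbit \<sigma> w) \<union> (X - orbit \<sigma> v - orbit \<sigma> w)" by blast
  also have "card \<dots> = card (X \<inter> orbit \<sigma> v) + card (X \<inter> orbit \<sigma> w) + card (X - orbit \<sigma> v - orbit \<sigma> w)"
    using dis finX by (subst card_Un_disjoint, auto)+
  finally show ?thesis using cardX by simp
qed

lemma half_le_outside:
  assumes "v \<in> V" "w \<in> V" "w \<notin> orbit \<sigma> v" "u \<in> V" "u \<notin> orbit \<sigma> v" "u \<notin> orbit \<sigma> w"
  shows "card (X \<inter> orbit \<sigma> v) + card (X \<inter> orbit \<sigma> w) + card (X \<inter> orbit \<sigma> u) \<le> a"
proof -
  have "orbit \<sigma> u \<inter> orbit \<sigma> v = {}" "orbit \<sigma> u \<inter> orbit \<sigma> w = {}"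
    using orb_eq assms orb_self by (metis disjoint_iff)+
  then have "card (X \<inter> orbit \<sigma> u) \<le> card (X - orbit \<sigma> v - orbit \<sigma> w)"
    using finX by (intro card_mono) auto
  then show ?thesis using disjoint_orbits_half[OF assms(1-3)] by simp
qed

lemma inner_degree_le:
  "inner_degree (orbit \<sigma> v) w \<le> 2 * card (X \<inter> orbit \<sigma> v)"
  using restricted_nbs_le[of "orbit \<sigma> v" "card (X \<inter> orbit \<sigma> v)" w] card_orbit_halves[of v]
  by (simp add: inner_degree_def)

text \<open>If nothing but \<open>x\<close> enters \<open>y = \<sigma> x\<close>, then
  \<open>y\<close> needs all \<open>a\<close> out-arcs to reach degree \<open>a + 1\<close>, and
  tightness forbids other arcs into \<open>x\<close>: the 2-cycle cannot be entered. If all of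
  \<open>X\<close> enters \<open>y\<close>, then tightness leaves \<open>x\<close> only the out-arc
  to \<open>y\<close>, so \<open>x\<close> has all in-arcs, and tightness at \<open>y\<close>
  forbids leaving from there: the 2-cycle cannot be left.\<close>

lemma two_cycle_mixed:
  assumes a3: "a \<ge> 3" and x: "x \<in> X" "\<sigma> (\<sigma> x) = x"
  shows "\<exists>u\<in>X - {x}. E u (\<sigma> x)" and "\<exists>u\<in>X - {x}. \<not> E u (\<sigma> x)"
proof -
  define y where "y = \<sigma> x"
  have xV: "x \<in> V" using x by auto
  have y: "y \<in> Y" "y \<in> V" "\<sigma> y = x" using \<sigma>_X[OF x(1)] x by (auto simp: y_def)
  have arcs: "E x y" "E y x" using E_\<sigma>[OF xV] E_\<sigma>[OF y(2)] y(3) by (simp_all add: y_def)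
  have XY: "w \<in> X \<Longrightarrow> w \<notin> Y" for w using disj by blast
  have yX: "y \<notin> X" using y XY by blast
  have dx: "deg x = a + 1" using two_cycle_tight(1)[OF a3 xV x(2)] .
  have dy: "deg y = a + 1" using two_cycle_tight(1)[OF a3 y(2)] y(3) by (simp add: y_def)
  have T1: "E x (\<sigma> w) \<longleftrightarrow> \<not> E w y" if "w \<in> X" "w \<noteq> x" for w
    using two_cycle_tight(2)[OF a3 xV x(2), of w] that x y yX unfolding y_def by auto
  have T2: "E y (\<sigma> w) \<longleftrightarrow> \<not> E w x" if "w \<in> Y" "w \<noteq> y" for w
    using two_cycle_tight(2)[OF a3 y(2), of w] that x y XY unfolding y_def by auto
  have orbx: "orbit \<sigma> x = {x, y}" using two_cycle_orbit[OF x(2)] by (simp add: y_def)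
  have in_y: "\<exists>u\<in>X - {x}. E u y"
  proof (rule ccontr)
    assume "\<not> ?thesis"
    then have "{w. E w y} = {x}" using bipY(2)[OF y(1)] arcs by blast
    then have "card {w. E y w} = a" using dy by (simp add: degree_def)
    then have "E y w" if "w \<in> X" for w using out_full(2)[OF _ y(1)] that by blast
    then have no: "\<not> E w x" if "w \<in> Y" "w \<noteq> y" for w using T2 \<sigma>_Y that by blast
    obtain s z where sz: "s \<in> V - {x, y}" "z \<in> {x, y}" "E s z" using arc_into_orbit[OF xV] orbx by metis
    show False
    proof (cases "z = x")
      case True
      then have "s \<in> Y" using bipX(2)[OF x(1)] sz by blast
      then show False using no[of s] sz True by blast
    next
      case False
      then have "E s y" using sz by blast
      then show False using \<open>{w. E w y} = {x}\<close> sz(1) by blast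
    qed
  qed
  have not_in_y: "\<exists>u\<in>X - {x}. \<not> E u y"
  proof (rule ccontr)
    assume "\<not> ?thesis"
    then have "\<not> E x w" if w: "w \<in> Y" "w \<noteq> y" for w
    proof -
      obtain u where u: "u \<in> V" "\<sigma> u = w" "u \<in> X" using \<sigma>_pred[of w] w(1) by blast
      then have "u \<noteq> x" using w(2) by (auto simp: y_def)
      then show ?thesis using T1[of u] u \<open>\<not> (\<exists>u\<in>X - {x}. \<not> E u y)\<close> by blast
    qed
    then have out_x: "{w. E x w} = {y}" using bipX(1)[OF x(1)] arcs by blast
    then have "card {w. E w x} = a" using dx by (simp add: degree_def)
    then have "E w x" if "w \<in> Y" for w using in_full(1)[OF _ x(1)] that by blast
    then have no: "\<not> E y (\<sigma> w)" if "w \<in> Y" "w \<noteq> y" for w using T2 that by blast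
    obtain s z where sz: "s \<in> {x, y}" "z \<in> V - {x, y}" "E s z" using arc_out_of_orbit[OF xV] orbx by metis
    then have "s = y" using out_x by blast
    then have "z \<in> X" using sz bipY(1)[OF y(1)] by blast
    then obtain w where w: "w \<in> V" "\<sigma> w = z" "w \<notin> X" using \<sigma>_pred[of z] XY by blast
    then have "w \<noteq> y" using sz(2) y(3) by blast
    then show False using no[of w] w sz(3) \<open>s = y\<close> by blast
  qed
  show "\<exists>u\<in>X - {x}. E u (\<sigma> x)" "\<exists>u\<in>X - {x}. \<not> E u (\<sigma> x)"
    using in_y not_in_y unfolding y_def .
qed

text \<open>A cycle of the factor of length two can always be inserted into the other one: by tightness
  some \<open>u \<rightarrow> y\<close> is followed on its cycle \<open>u, t, z, r, p, q, \<dots>\<close> by \<open>x \<rightarrow> r\<close>, and the displaced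
  vertices \<open>t\<close> and \<open>z\<close>, which together miss at most one arc outside \<open>{x, y}\<close>, can be placed
  either between \<open>p\<close> and \<open>q\<close> or, in reverse order, between \<open>r\<close> and \<open>p\<close>.\<close>

lemma no_two_cycle_X:
  assumes a4: "a \<ge> 4" and x: "x \<in> X" "\<sigma> (\<sigma> x) = x"
  shows False
proof -
  define y where "y = \<sigma> x"
  have a3: "a \<ge> 3" and xV: "x \<in> V" using a4 x by auto
  have y: "y \<in> Y" "y \<in> V" "\<sigma> y = x" using \<sigma>_X[OF x(1)] x by (auto simp: y_def)
  have arcs: "E x y" "E y x" using E_\<sigma>[OF xV] E_\<sigma>[OF y(2)] y(3) by (simp_all add: y_def)
  have XY: "w \<in> X \<Longrightarrow> w \<notin> Y" for w using disj by blast
  have yX: "y \<notin> X" using y XY by blast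
  have dx: "deg x = a + 1" using two_cycle_tight(1)[OF a3 xV x(2)] .
  have dy: "deg y = a + 1" using two_cycle_tight(1)[OF a3 y(2)] y(3) by (simp add: y_def)
  have T1: "E x (\<sigma> w) \<longleftrightarrow> \<not> E w y" if "w \<in> X" "w \<noteq> x" for w
    using two_cycle_tight(2)[OF a3 xV x(2), of w] that x y yX unfolding y_def by auto
  have T2: "E y (\<sigma> w) \<longleftrightarrow> \<not> E w x" if "w \<in> Y" "w \<noteq> y" for w
    using two_cycle_tight(2)[OF a3 y(2), of w] that x y XY unfolding y_def by auto
  \<comment> \<open>By tightness either \<open>w\<close> points into the 2-cycle or the 2-cycle
    points to \<open>\<sigma> w\<close>. In both cases \<open>w\<close> shares an out-neighbour with
    \<open>x\<close> or \<open>y\<close>, whose degree \<open>a + 1\<close> is below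
    \<open>2 * a - 2\<close>.\<close>
  have big: "2 * a - 2 \<le> deg w" if w: "w \<in> V" "w \<noteq> x" "w \<noteq> y" for w
  proof -
    have "\<exists>z s. E w z \<and> E s z \<and> s \<noteq> w \<and> deg s = a + 1"
      using T1[of w] T2[of w] w E_\<sigma>[OF w(1)] arcs dx dy by (metis UnE)
    then obtain z s where "E w z" "E s z" "s \<noteq> w" "deg s = a + 1" by blast
    from dom[OF this(1,2)] this(3,4) show ?thesis using a4 by auto
  qed
  have orbx: "orbit \<sigma> x = {x, y}" using two_cycle_orbit[OF x(2)] by (simp add: y_def)
  \<comment> \<open>With half-length \<open>c\<close>, the degree sums give
    \<open>2 * a - 2 \<le> 2 * c + (a - c)\<close>. Two cycles this long and the 2-cycle would use
    at least \<open>2 * (a - 2) + 1 > a\<close> vertices of \<open>X\<close>, so there is only one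
    other cycle.\<close>
  have other: "card (X \<inter> orbit \<sigma> w) + 2 \<ge> a" if w: "w \<in> V" "w \<notin> {x, y}" for w
  proof -
    let ?C = "orbit \<sigma> w" and ?c = "card (X \<inter> orbit \<sigma> w)"
    have "x \<notin> ?C" "y \<notin> ?C" using w orbx orb_eq[of x w] orb_self[of w] orb_eq[of y w] orb_eq[of y x] by auto
    then have "(\<Sum>z\<in>?C. deg z) \<ge> (\<Sum>z\<in>?C. 2 * a - 2)"
      using big orb_V[OF w(1)] by (intro sum_mono) blast
    moreover have "(\<Sum>z\<in>?C. inner_degree ?C z) \<le> (\<Sum>z\<in>?C. 2 * ?c)"
      by (rule sum_mono) (rule inner_degree_le)
    moreover have "?c \<le> a" using card_mono[OF finX, of "X \<inter> ?C"] cardX by simp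
    ultimately have "2 * ?c * (2 * a - 2) \<le> 2 * ?c * (2 * ?c) + 2 * ?c * (a - ?c)"
      using orbit_degree_sum(1)[OF w(1)] card_orbit[OF w(1)] by simp
    then have "2 * ?c * (2 * a - 2) \<le> 2 * ?c * (2 * ?c + (a - ?c))" by (simp add: algebra_simps)
    then have "2 * a - 2 \<le> 2 * ?c + (a - ?c)"
      using orbit_half_pos[OF w(1)] by simp
    then show ?thesis using \<open>?c \<le> a\<close> by linarith
  qed
  have halfx: "card (X \<inter> orbit \<sigma> x) = 1" using x yX by (simp add: orbx)
  have single: "orbit \<sigma> w = V - {x, y}" if w: "w \<in> V" "w \<notin> {x, y}" for w
  proof (rule ccontr)
    assume ne: "\<not> ?thesis"
    have "orbit \<sigma> w \<subseteq> V - {x, y}"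
      using orb_V[OF w(1)] w orbx orb_eq[of x w] orb_self[of w] orb_eq[of y w] orb_eq[of y x] by auto
    then obtain s where s: "s \<in> V" "s \<notin> {x, y}" "s \<notin> orbit \<sigma> w" using ne by blast
    then show False
      using half_le_outside[OF xV w(1) _ s(1)] other[OF w] other[OF s(1,2)] w halfx orbx a4 by auto
  qed
  note in_y = two_cycle_mixed(1)[OF a3 x, folded y_def]
  note not_in_y = two_cycle_mixed(2)[OF a3 x, folded y_def]
  have "\<exists>u\<in>X - {x}. E u y \<and> \<not> E (\<sigma> (\<sigma> u)) y"
  proof (rule ccontr)
    assume no: "\<not> ?thesis"
    obtain u where u: "u \<in> X" "u \<noteq> x" "E u y" using in_y by blast
    \<comment> \<open>The negated claim carries \<open>E w y\<close> two steps along the cycle, from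
      one vertex of \<open>X\<close> to the next. For \<open>w\<close> in \<open>Y\<close> the set
      asks for the property at the successor, which makes it closed under single steps of
      \<open>\<sigma>\<close>.\<close>
    let ?S = "{w \<in> V - {x, y}. if w \<in> X then E w y else E (\<sigma> w) y}"
    have uC: "u \<in> V" "u \<notin> {x, y}" using u yX by auto
    have "orbit \<sigma> u \<subseteq> ?S"
    proof (rule orbit_closed_subset)
      show "u \<in> ?S" using u yX by auto
      fix w assume w: "w \<in> ?S"
      then have "\<sigma> w \<in> orbit \<sigma> u" using single[OF uC] orb_step by blast
      then have "\<sigma> w \<in> V - {x, y}" using single[OF uC] by blast
      moreover have "if \<sigma> w \<in> X then E (\<sigma> w) y else E (\<sigma> (\<sigma> w)) y"
      proof (cases "w \<in> X")
        case True
        then have "E (\<sigma> (\<sigma> w)) y" using w no by auto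
        then show ?thesis using \<sigma>_X[OF True] XY by auto
      next
        case False
        then show ?thesis using w \<sigma>_Y[of w] by auto
      qed
      ultimately show "\<sigma> w \<in> ?S" by blast
    qed
    then have S: "w \<in> ?S" if "w \<in> V - {x, y}" for w
      using that single[OF uC] by blast
    obtain w where w: "w \<in> X" "w \<noteq> x" "\<not> E w y" using not_in_y by blast
    then have "w \<in> V - {x, y}" using yX by blast
    from S[OF this] w show False by simp
  qed
  then obtain u where u: "u \<in> X" "u \<noteq> x" "E u y" and nz: "\<not> E (\<sigma> (\<sigma> u)) y" by blast
  define t where "t = \<sigma> u"
  define z where "z = \<sigma> t"
  define r where "r = \<sigma> z"
  define p where "p = \<sigma> r"
  define q where "q = \<sigma> p"
  note defs = t_def z_def r_def p_def q_def
  have sides: "t \<in> Y" "z \<in> X" "r \<in> Y" "p \<in> X" "q \<in> Y"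
    using \<sigma>_X \<sigma>_Y u by (simp_all add: defs)
  have uV: "u \<in> V" "u \<notin> {x, y}" using u yX by auto
  have orbu: "orbit \<sigma> u = V - {x, y}" using single[OF uV] .
  have in_orb: "t \<in> orbit \<sigma> u" "z \<in> orbit \<sigma> u" "r \<in> orbit \<sigma> u" "p \<in> orbit \<sigma> u" "q \<in> orbit \<sigma> u"
    using orb_self orb_step by (simp_all add: defs)
  then have notxy: "t \<notin> {x, y}" "z \<notin> {x, y}" "r \<notin> {x, y}" "p \<notin> {x, y}" "q \<notin> {x, y}"
    using orbu by auto
  have orbr: "orbit \<sigma> r = V - {x, y}" using orb_eq[OF in_orb(3)] orbu by simp
  obtain N where N: "N > 0" "(\<sigma> ^^ N) r = r"
      "hamiltonian_list (orbit \<sigma> r) E (map (\<lambda>i. (\<sigma> ^^ i) r) [0..<N])"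
    using cycle_factor_orbit_list[OF factor finV, of r] sides by blast
  define f where "f i = (\<sigma> ^^ i) r" for i
  have f: "f 0 = r" "f 1 = p" "f 2 = q" "f N = r" and fS: "\<And>i. f (Suc i) = \<sigma> (f i)"
    using N(2) by (simp_all add: f_def p_def q_def eval_nat_numeral)
  have L: "hamiltonian_list (V - {x, y}) E (map f [0..<N])"
    using N(3) orbr unfolding f_def by simp
  have "N = length (map f [0..<N])" by simp
  also have "\<dots> = card (V - {x, y})" using L distinct_card unfolding hamiltonian_list_def by metis
  also have "\<dots> = 2 * a - 2"
  proof -
    have "card {x, y} = 2" using x(1) yX by (simp add: card_2_iff) blast
    moreover have "card V = 2 * a" using card_Un_disjoint[OF finX finY disj] cardX cardY by simp
    moreover have "card (V - {x, y}) = card V - card {x, y}" using x y by (intro card_Diff_subset) auto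
    ultimately show ?thesis by simp
  qed
  finally have N: "N = 2 * a - 2" .
  have Sucs: "Suc (N - 1) = N" "Suc (N - 2) = N - 1" "Suc (N - 3) = N - 2" using N a4 by simp_all
  have f1: "f (N - 1) = z"
    using fS[of "N - 1"] unfolding Sucs f(4) r_def by (simp add: \<sigma>_inj)
  have f2: "f (N - 2) = t"
    using fS[of "N - 2"] unfolding Sucs f1 unfolding z_def by (simp add: \<sigma>_inj)
  have f3: "f (N - 3) = u"
    using fS[of "N - 3"] unfolding Sucs f2 unfolding t_def by (simp add: \<sigma>_inj)
  \<comment> \<open>As \<open>N \<ge> 6\<close>, the listing has room for \<open>r\<close>,
    \<open>p\<close> at the front and \<open>t\<close>, \<open>z\<close> at the end.
    \<open>M\<close> runs from \<open>q\<close> to \<open>u\<close> and stays intact in both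
    rerouted cycles.\<close>
  define M where "M = map f [2..<N - 2]"
  have ups: "[0..<N] = 0 # 1 # [2..<N - 2] @ [N - 2, N - 1]"
  proof -
    have Suc_eqs: "N = Suc (Suc (N - 2))" "N - 1 = Suc (N - 2)" "2 < N - 2" using N a4 by simp_all
    have "[0..<N] = [0..<N - 2] @ [N - 2, N - 1]"
      by (subst Suc_eqs(1)) (simp add: Suc_eqs(2)[simplified])
    moreover have "[0..<N - 2] = 0 # 1 # [2..<N - 2]"
      using Suc_eqs(3) by (simp add: upt_conv_Cons numeral_2_eq_2)
    ultimately show ?thesis by simp
  qed
  have LM: "map f [0..<N] = r # p # M @ [t, z]"
    unfolding ups M_def using f f1 f2 by simp
  have Mne: "M \<noteq> []" "hd M = q" "last M = u"
    using N a4 f f3 unfolding M_def by (auto simp: hd_map last_map upt_eq_Nil_conv)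
  have dist: "distinct (r # p # M @ [t, z])" and set: "set (r # p # M @ [t, z]) = V - {x, y}"
    and succ: "successively E M" and rp: "E r p" and pq: "E p q" and tz: "E t z"
    using L Mne unfolding LM hamiltonian_list_def by (auto simp: successively_append_iff successively_Cons)
  have xr: "E x r" using T1[of z] nz sides notxy by (simp add: r_def z_def t_def)
  have xny: "x \<noteq> y" using x yX by blast
  have listA: False if "E p t" "E z q"
  proof -
    have "hamiltonian_list V E (x # r # p # t # z # M @ [y])"
      unfolding hamiltonian_list_def
    proof (intro conjI)
      show "distinct (x # r # p # t # z # M @ [y])" using dist set xny by auto
      show "set (x # r # p # t # z # M @ [y]) = V" using set x y by auto
      show "successively E (x # r # p # t # z # M @ [y])"
        using that xr rp tz succ Mne u by (auto simp: successively_append_iff successively_Cons)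
    qed (use arcs in auto)
    then show False using not_ham by blast
  qed
  have listB: False if "E r z" "E z t" "E t p"
  proof -
    have "hamiltonian_list V E (x # r # z # t # p # M @ [y])"
      unfolding hamiltonian_list_def
    proof (intro conjI)
      show "distinct (x # r # z # t # p # M @ [y])" using dist set xny by auto
      show "set (x # r # z # t # p # M @ [y]) = V" using set x y by auto
      show "successively E (x # r # z # t # p # M @ [y])"
        using that xr pq succ Mne u by (auto simp: successively_append_iff successively_Cons)
    qed (use arcs in auto)
    then show False using not_ham by blast
  qed
  have ntx: "\<not> E x t" using T1[of u] u by (simp add: t_def)
  have nzy: "\<not> E z y" using nz by (simp add: z_def t_def)
  \<comment> \<open>So exactly one of \<open>t\<close> and \<open>z\<close> misses both possible
    arcs on the 2-cycle side and therefore has all its other arcs. The other one can miss at most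
    one more, and whether it does so at the arc needed for \<open>listA\<close> decides between
    \<open>listA\<close> and \<open>listB\<close>.\<close>
  have yz: "E y z \<longleftrightarrow> \<not> E t x" using T2[of t] sides notxy by (simp add: z_def)
  have bigt: "2 * a - 2 \<le> deg t" and bigz: "2 * a - 2 \<le> deg z" using big sides notxy by auto
  have tX: "t \<notin> X" "r \<notin> X" "q \<notin> X" using sides XY by auto
  have mt: "card P + card Q \<le> 2" if "P \<union> Q \<subseteq> {x, p, z}" "\<And>s. s \<in> P \<Longrightarrow> \<not> E s t" "\<And>s. s \<in> Q \<Longrightarrow> \<not> E t s" for P Q
    by (rule misses_big[OF bigt]) (use that sides x tX in auto)
  have mz: "card P + card Q \<le> 2" if "P \<union> Q \<subseteq> {y, q, r, t}" "\<And>s. s \<in> P \<Longrightarrow> \<not> E s z" "\<And>s. s \<in> Q \<Longrightarrow> \<not> E z s" for P Q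
    by (rule misses_big[OF bigz]) (use that sides y yX tX in auto)
  show False
  proof (cases "E t x")
    case False
    have "E p t"
      proof (rule ccontr)
        assume n: "\<not> ?thesis"
        have "card {x, p} + card {x} \<le> 2" by (rule mt) (use n ntx False in auto)
        then show False using notxy by auto
      qed
    have "E z t"
      proof (rule ccontr)
        assume n: "\<not> ?thesis"
        have "card {x, z} + card {x} \<le> 2" by (rule mt) (use n ntx False in auto)
        then show False using notxy by auto
      qed
    have "E t p"
      proof (rule ccontr)
        assume n: "\<not> ?thesis"
        have "card {x} + card {x, p} \<le> 2" by (rule mt) (use n ntx False in auto)
        then show False using notxy by auto
      qed
    show False
    proof (cases "E z q")
      case True
      then show False using listA \<open>E p t\<close> by blast
    next
      case no: False
      have "E r z"
      proof (rule ccontr)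
        assume n: "\<not> ?thesis"
        have "card {r} + card {y, q} \<le> 2" by (rule mz) (use n no nzy in auto)
        then show False using notxy by auto
      qed
      then show False using listB \<open>E z t\<close> \<open>E t p\<close> by blast
    qed
  next
    case True
    then have nyz: "\<not> E y z" using yz by blast
    have "E z q"
      proof (rule ccontr)
        assume n: "\<not> ?thesis"
        have "card {y} + card {y, q} \<le> 2" by (rule mz) (use n nzy nyz in auto)
        then show False using notxy by auto
      qed
    have "E z t"
      proof (rule ccontr)
        assume n: "\<not> ?thesis"
        have "card {y} + card {y, t} \<le> 2" by (rule mz) (use n nzy nyz in auto)
        then show False using notxy by auto
      qed
    have "E r z"
      proof (rule ccontr)
        assume n: "\<not> ?thesis"
        have "card {y, r} + card {y} \<le> 2" by (rule mz) (use n nzy nyz in auto)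
        then show False using notxy by auto
      qed
    show False
    proof (cases "E p t")
      case True
      then show False using listA \<open>E z q\<close> by blast
    next
      case no: False
      have "E t p"
      proof (rule ccontr)
        assume n: "\<not> ?thesis"
        have "card {x, p} + card {p} \<le> 2" by (rule mt) (use n no ntx in auto)
        then show False using notxy by auto
      qed
      then show False using listB \<open>E z t\<close> \<open>E r z\<close> by blast
    qed
  qed
qed

lemma no_two_cycle:
  assumes "a \<ge> 4" "v \<in> V"
  shows "\<sigma> (\<sigma> v) \<noteq> v"
proof -
  interpret sw: maximal_factor Y X E a \<sigma> by (rule swap_maximal)
  show ?thesis using no_two_cycle_X sw.no_two_cycle_X assms by blast
qed

lemma orbit_half_ge_2:
  assumes "a \<ge> 4" "v \<in> V"
  shows "card (X \<inter> orbit \<sigma> v) \<ge> 2"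
proof (rule ccontr)
  assume "\<not> ?thesis"
  then have "card (orbit \<sigma> v) = 2"
    using orbit_half_pos[OF assms(2)] card_orbit[OF assms(2)] by simp
  moreover have "{v, \<sigma> v, \<sigma> (\<sigma> v)} \<subseteq> orbit \<sigma> v" using orb_self orb_step by auto
  moreover have "card {v, \<sigma> v, \<sigma> (\<sigma> v)} = 3"
  proof -
    have "\<sigma> v \<noteq> v" using E_\<sigma>[OF assms(2)] bip[of v "\<sigma> v"] disj by auto
    then show ?thesis using no_two_cycle[OF assms] \<sigma>_inj[of "\<sigma> v" v] by auto
  qed
  moreover have "finite (orbit \<sigma> v)" using orb_V[OF assms(2)] finV finite_subset by blast
  ultimately show False using card_mono[of "orbit \<sigma> v" "{v, \<sigma> v, \<sigma> (\<sigma> v)}"] by linarith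
qed

end

section \<open>Long cycles\<close>

text \<open>Here \<open>c\<close> is half the length of a cycle, \<open>m\<close> and
  \<open>m'\<close> count the vertices of degree below \<open>2 * a - 2\<close> in its halves,
  \<open>k\<close> and \<open>k'\<close> bound the in-degrees within the cycle of vertices in the
  opposite half, \<open>w\<close> is the number of arcs inside, and \<open>S\<close> the degree sum.
  Once \<open>a \<le> c + 3\<close> is known, \<open>2 * c \<le> a\<close> leaves only three pairs
  \<open>(a, c)\<close>.\<close>

lemma degree_sum_arith:
  fixes a c m m' k k' w S :: nat
  assumes a4: "4 \<le> a" and c: "2 \<le> c" "2 * c \<le> a" and m: "m \<le> c" "m' \<le> c"
    and k: "k \<le> c" "k + m \<le> c + 1" "k' \<le> c" "k' + m' \<le> c + 1"
    and w: "w \<le> c * (k + k')"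
    and S: "2 * c * (2 * a - 2) \<le> S + (m + m') * (a - 3)" "S \<le> 2 * w + 2 * c * (a - c)"
  shows "a = c + 3 \<and> m = 1 \<and> m' = 1 \<and> w = 2 * c * c \<and> S = 2 * w + 2 * c * (a - c)
    \<or> a = 4 \<and> c = 2 \<and> (w = 2 * c * c \<or> m = 1 \<and> m' = 1 \<and> S = 2 * w + 2 * c * (a - c))"
proof -
  define n K where "n = m + m'" and "K = k + k'"
  have main: "2 * c * (2 * a - 2) \<le> 2 * (c * K) + 2 * c * (a - c) + n * (a - 3)"
    using S w unfolding n_def K_def by linarith
  have "a \<le> c + 3"
  proof (rule ccontr)
    assume "\<not> ?thesis"
    then have "c + 4 \<le> a" by simp
    then obtain d where d: "a = c + 4 + d" by (auto simp: le_iff_add)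
    have "2 * a - 2 = 2 * c + 6 + 2 * d" "a - c = 4 + d" "a - 3 = c + 1 + d" using d by simp_all
    then have main: "2 * c * (2 * c + 6 + 2 * d) \<le> 2 * (c * K) + 2 * c * (4 + d) + n * (c + 1 + d)"
      using main by simp
    \<comment> \<open>The bound \<open>k + m \<le> c + 1\<close> is too weak when both
      \<open>m\<close> and \<open>m'\<close> vanish, as it then allows \<open>K = 2 * c + 2\<close>;
      that case uses \<open>K \<le> 2 * c\<close> instead.\<close>
    show False
    proof (cases "n = 0")
      case True
      then have "2 * c * (2 * c + 6 + 2 * d) \<le> 2 * c * (K + (4 + d))"
        using main by (simp add: algebra_simps)
      then have "2 * c + 6 + 2 * d \<le> K + (4 + d)"
        by (rule mult_left_le_imp_le) (use c in simp)
      then show False using k by (simp add: K_def)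
    next
      case False
      have "c * (K + n) \<le> c * (2 * c + 2)" using k by (intro mult_left_mono) (auto simp: K_def n_def)
      then have h1: "c * K + c * n \<le> 2 * (c * c) + 2 * c" by (simp add: algebra_simps)
      have "n * d \<le> (2 * c) * d" using m by (intro mult_right_mono) (auto simp: n_def)
      then have h2: "n * d \<le> 2 * (c * d)" by (simp only: mult.assoc)
      have h3: "2 * n \<le> c * n" using c by (intro mult_right_mono) auto
      have h4: "4 * (c * c) + 12 * c + 4 * (c * d) \<le> 2 * (c * K) + 8 * c + 2 * (c * d) + c * n + n + n * d"
        using main by (simp add: algebra_simps)
      show False using h1 h2 h3 h4 False by linarith
    qed
  qed
  then consider "a = 4" "c = 2" | "a = 5" "c = 2" | "a = 6" "c = 3"
    using a4 c by linarith
  then show ?thesis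
  proof cases
    case 1
    have "m = 0 \<or> m = 1 \<or> m = 2" "m' = 0 \<or> m' = 1 \<or> m' = 2" using m 1 by linarith+
    then have "w = 8 \<or> m = 1 \<and> m' = 1 \<and> S = 2 * w + 8"
      using k w S unfolding 1 by (elim disjE; simp; linarith)
    then show ?thesis using 1 by simp
  next
    case 2
    have "m = 0 \<or> m = 1 \<or> m = 2" "m' = 0 \<or> m' = 1 \<or> m' = 2" using m 2 by linarith+
    then have "m = 1 \<and> m' = 1 \<and> w = 8 \<and> S = 2 * w + 12"
      using k w S unfolding 2 by (elim disjE; simp; linarith)
    then show ?thesis using 2 by simp
  next
    case 3
    have "m = 0 \<or> m = 1 \<or> m = 2 \<or> m = 3" "m' = 0 \<or> m' = 1 \<or> m' = 2 \<or> m' = 3"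
      using m 3 by linarith+
    then have "m = 1 \<and> m' = 1 \<and> w = 18 \<and> S = 2 * w + 18"
      using k w S unfolding 3 by (elim disjE; simp; linarith)
    then show ?thesis using 3 by simp
  qed
qed

lemma orbit_conj:
  assumes "\<And>w. \<pi> (\<pi> w) = w"
  shows "orbit (\<pi> \<circ> \<sigma> \<circ> \<pi>) w = \<pi> ` orbit \<sigma> (\<pi> w)"
proof (intro equalityI subsetI)
  fix s assume "s \<in> orbit (\<pi> \<circ> \<sigma> \<circ> \<pi>) w"
  then show "s \<in> \<pi> ` orbit \<sigma> (\<pi> w)"
  proof induction
    case (step s)
    then show ?case using assms orbit.step[of _ \<sigma> "\<pi> w"] by auto
  qed (use orbit.base[of \<sigma> "\<pi> w"] in auto)
next
  fix s assume "s \<in> \<pi> ` orbit \<sigma> (\<pi> w)"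
  then obtain t where t: "t \<in> orbit \<sigma> (\<pi> w)" "s = \<pi> t" by blast
  from t(1) have "\<pi> t \<in> orbit (\<pi> \<circ> \<sigma> \<circ> \<pi>) w"
  proof induction
    case base
    then show ?case using orbit.base[of "\<pi> \<circ> \<sigma> \<circ> \<pi>" w] by (simp add: o_def)
  next
    case (step t)
    then show ?case using orbit.step[OF step(2)] assms by (simp add: o_def)
  qed
  then show "s \<in> orbit (\<pi> \<circ> \<sigma> \<circ> \<pi>) w" using t(2) by simp
qed

section \<open>Cycles covering at most half of the vertices\<close>

context maximal_factor begin

definition nonbig :: "'a set \<Rightarrow> 'a set" where
  "nonbig C = {w \<in> C. deg w < 2 * a - 2}"

text \<open>Two vertices of degree below \<open>2 * a - 2\<close> cannot share the out-neighbour
  \<open>y\<close>, so the two sets overlap in at most one vertex.\<close>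

lemma nonbig_in_nbs:
  assumes "finite S"
  shows "card {z\<in>S. E z y} + card (nonbig S) \<le> card S + 1"
proof -
  let ?A = "{z\<in>S. E z y}"
  have fin: "finite ?A" "finite (nonbig S)" using assms by (auto simp: nonbig_def)
  have "card (?A \<inter> nonbig S) \<le> Suc 0"
  proof (subst card_le_Suc0_iff_eq)
    show "\<forall>z\<in>?A \<inter> nonbig S. \<forall>s\<in>?A \<inter> nonbig S. z = s"
    proof (intro ballI, rule ccontr)
      fix z s assume "z \<in> ?A \<inter> nonbig S" "s \<in> ?A \<inter> nonbig S" "z \<noteq> s"
      then show False using dom[of z y s] by (auto simp: nonbig_def)
    qed
  qed (use fin in simp)
  moreover have "card (?A \<union> nonbig S) \<le> card S"
    using assms by (intro card_mono) (auto simp: nonbig_def)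
  ultimately show ?thesis using card_Un_Int[OF fin] by simp
qed

lemma inner_degree_sum:
  assumes v: "v \<in> V"
  defines "C \<equiv> orbit \<sigma> v"
  shows "(\<Sum>w\<in>C. inner_degree C w) = 2 * (\<Sum>w\<in>C. card {z\<in>C. E z w})"
proof -
  have fin: "finite C" using orb_V[OF v] finV finite_subset unfolding C_def by blast
  have "(\<Sum>w\<in>C. card {z\<in>C. E w z}) = (\<Sum>w\<in>C. \<Sum>z\<in>C. if E w z then 1 else 0)"
    using fin by (simp add: sum.If_cases Int_def)
  also have "\<dots> = (\<Sum>z\<in>C. \<Sum>w\<in>C. if E w z then 1 else 0)" by (rule sum.swap)
  also have "\<dots> = (\<Sum>w\<in>C. card {z\<in>C. E z w})"
    using fin by (simp add: sum.If_cases Int_def)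
  finally show ?thesis by (simp add: inner_degree_def sum.distrib)
qed

text \<open>The equalities of \<open>degree_sum_arith\<close> are read back combinatorially:
  \<open>w = 2 * c * c\<close> means that all arcs between the halves of the cycle are present, and
  equality in the upper bound on \<open>S\<close> is the equality case of
  \<open>orbit_degree_sum\<close>.\<close>

lemma orbit_cases:
  assumes a4: "a \<ge> 4" and v: "v \<in> V"
  defines "C \<equiv> orbit \<sigma> v"
  defines "c \<equiv> card (X \<inter> C)"
  defines "C_complete \<equiv> \<forall>w\<in>C. \<forall>z\<in>C. (w \<in> X \<longleftrightarrow> z \<notin> X) \<longrightarrow> E w z"
    and "C_tight \<equiv> \<forall>u\<in>C. \<forall>p\<in>V - C. (p \<in> X \<longleftrightarrow> u \<in> X) \<longrightarrow> E u (\<sigma> p) \<or> E p (\<sigma> u)"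
  assumes c2: "2 * c \<le> a"
  shows "a = c + 3 \<and> nonbig (X \<inter> C) \<noteq> {} \<and> nonbig (Y \<inter> C) \<noteq> {} \<and> C_complete \<and> C_tight
    \<or> a = 4 \<and> c = 2 \<and> (C_complete \<or> nonbig (X \<inter> C) \<noteq> {} \<and> C_tight)"
proof -
  define m m' where "m = card (nonbig (X \<inter> C))" and "m' = card (nonbig (Y \<inter> C))"
  have CV: "C \<subseteq> V" using orb_V[OF v] by (simp add: C_def)
  have finC: "finite C" using CV finV finite_subset by blast
  have cY: "card (Y \<inter> C) = c" using card_orbit_halves[of v] by (simp add: c_def C_def)
  have finXC: "finite (X \<inter> C)" "finite (Y \<inter> C)" using finX finY by auto
  have m: "m \<le> c" "m' \<le> c"
    using card_mono[OF finXC(1), of "nonbig (X \<inter> C)"] card_mono[OF finXC(2), of "nonbig (Y \<inter> C)"] cY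
    by (auto simp: m_def m'_def c_def nonbig_def)
  \<comment> \<open>Bounds the in-neighbours on the cycle of a vertex in \<open>Y\<close>: at most
    \<open>c\<close> in all, and at most one of the \<open>m\<close> vertices of low degree.\<close>
  define k where "k = min c (c + 1 - m)"
  define k' where "k' = min c (c + 1 - m')"
  have k: "k \<le> c" "k + m \<le> c + 1" "k' \<le> c" "k' + m' \<le> c + 1" using m by (auto simp: k_def k'_def)
  define w where "w = (\<Sum>w\<in>C. card {z\<in>C. E z w})"
  have split: "(\<Sum>w\<in>C. f w) = (\<Sum>w\<in>X \<inter> C. f w) + (\<Sum>w\<in>Y \<inter> C. f w)" for f :: "'a \<Rightarrow> nat"
  proof -
    have "C = (X \<inter> C) \<union> (Y \<inter> C)" using CV by blast
    then show ?thesis using sum.union_disjoint[OF finXC, of f] disj by auto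
  qed
  have in_le: "card {z\<in>C. E z y} \<le> c" for y
    using restricted_nbs_le(2)[of C c y] cY by (simp add: c_def)
  have "card {z\<in>C. E z y} \<le> k" if "y \<in> Y \<inter> C" for y
  proof -
    have "{z\<in>C. E z y} = {z\<in>X \<inter> C. E z y}" using that bipY(2) by blast
    then show ?thesis
      using nonbig_in_nbs[OF finXC(1), of y] in_le[of y] by (simp add: k_def m_def c_def)
  qed
  then have sY: "(\<Sum>y\<in>Y \<inter> C. card {z\<in>C. E z y}) \<le> c * k"
    using sum_bounded_above[of "Y \<inter> C" "\<lambda>y. card {z\<in>C. E z y}" k] cY by simp
  have "card {z\<in>C. E z y} \<le> k'" if "y \<in> X \<inter> C" for y
  proof -
    have "{z\<in>C. E z y} = {z\<in>Y \<inter> C. E z y}" using that bipX(2) by blast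
    then show ?thesis
      using nonbig_in_nbs[OF finXC(2), of y] in_le[of y] by (simp add: k'_def m'_def cY)
  qed
  then have sX: "(\<Sum>y\<in>X \<inter> C. card {z\<in>C. E z y}) \<le> c * k'"
    using sum_bounded_above[of "X \<inter> C" "\<lambda>y. card {z\<in>C. E z y}" k'] by (simp add: c_def)
  have w: "w \<le> c * (k + k')" using sX sY unfolding w_def split by (simp add: algebra_simps)
  define S where "S = (\<Sum>w\<in>C. deg w)"
  have inner: "(\<Sum>w\<in>C. inner_degree C w) = 2 * w"
    using inner_degree_sum[OF v] by (simp add: C_def w_def)
  have S1: "S \<le> 2 * w + 2 * c * (a - c)"
    using orbit_degree_sum(1)[OF v] inner unfolding S_def C_def c_def by simp
  have cardC: "card C = 2 * c" using card_orbit[OF v] by (simp add: C_def c_def)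
  have nonbigC: "card (nonbig C) = m + m'"
  proof -
    have "nonbig C = nonbig (X \<inter> C) \<union> nonbig (Y \<inter> C)" using CV by (auto simp: nonbig_def)
    moreover have "nonbig (X \<inter> C) \<inter> nonbig (Y \<inter> C) = {}" using disj by (auto simp: nonbig_def)
    moreover have "finite (nonbig (X \<inter> C))"
      by (rule finite_subset[OF _ finXC(1)]) (auto simp: nonbig_def)
    moreover have "finite (nonbig (Y \<inter> C))"
      by (rule finite_subset[OF _ finXC(2)]) (auto simp: nonbig_def)
    ultimately show ?thesis by (simp add: card_Un_disjoint m_def m'_def)
  qed
  \<comment> \<open>By \<open>no_small\<close>, a vertex falls short of \<open>2 * a - 2\<close> by
    at most \<open>(2 * a - 2) - (a + 1) = a - 3\<close>.\<close>
  have "(\<Sum>w\<in>C. 2 * a - 2) \<le> (\<Sum>w\<in>C. deg w + (if w \<in> nonbig C then a - 3 else 0))"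
    using no_small[OF a4] CV by (intro sum_mono) (fastforce simp: nonbig_def)
  also have "\<dots> = S + card (nonbig C) * (a - 3)"
  proof -
    have "C \<inter> nonbig C = nonbig C" by (auto simp: nonbig_def)
    then show ?thesis using finC by (simp add: sum.distrib S_def sum.If_cases Int_def[symmetric])
  qed
  finally have S2: "2 * c * (2 * a - 2) \<le> S + (m + m') * (a - 3)" using cardC nonbigC by simp
  have complete: C_complete if "w = 2 * c * c"
    unfolding C_complete_def
  proof (intro ballI impI)
    fix s z assume sz: "s \<in> C" "z \<in> C" "s \<in> X \<longleftrightarrow> z \<notin> X"
    have "(\<Sum>w\<in>C. card {z\<in>C. E z w}) = (\<Sum>w\<in>C. c)" using that cardC by (simp add: w_def)
    then have full: "card {s\<in>C. E s z} = c"
      using sz(2) in_le sum_mono_inv[of "\<lambda>w. card {z\<in>C. E z w}" C "\<lambda>_. c" z] finC by blast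
    show "E s z"
    proof (cases "z \<in> X")
      case True
      have "{s\<in>C. E s z} = Y \<inter> C"
        by (rule card_subset_eq[OF finXC(2)]) (use full cY bipX(2)[OF True] in auto)
      then show ?thesis using sz True CV by blast
    next
      case False
      then have "z \<in> Y" using sz CV by blast
      have "{s\<in>C. E s z} = X \<inter> C"
        by (rule card_subset_eq[OF finXC(1)]) (use full bipY(2)[OF \<open>z \<in> Y\<close>] in \<open>auto simp: c_def\<close>)
      then show ?thesis using sz False CV by blast
    qed
  qed
  have tight: C_tight if "S = 2 * w + 2 * c * (a - c)"
    unfolding C_tight_def
  proof (intro ballI impI)
    fix u p assume "u \<in> C" "p \<in> V - C" "p \<in> X \<longleftrightarrow> u \<in> X"
    then show "E u (\<sigma> p) \<or> E p (\<sigma> u)"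
      using orbit_degree_sum(2)[OF v, folded C_def, of u p] that inner unfolding S_def c_def by simp
  qed
  have ne: "m = 1 \<Longrightarrow> nonbig (X \<inter> C) \<noteq> {}" "m' = 1 \<Longrightarrow> nonbig (Y \<inter> C) \<noteq> {}"
    by (auto simp: m_def m'_def)
  have "2 \<le> c" using orbit_half_ge_2[OF a4 v] by (simp add: c_def C_def)
  from degree_sum_arith[OF a4 this c2 m k w S2 S1] show ?thesis
  proof (elim disjE conjE)
    assume "a = c + 3" "m = 1" "m' = 1" "w = 2 * c * c" "S = 2 * w + 2 * c * (a - c)"
    then show ?thesis using complete tight ne by simp
  next
    assume "a = 4" "c = 2" "w = 2 * c * c"
    then show ?thesis using complete by simp
  next
    assume "a = 4" "c = 2" "m = 1" "S = 2 * w + 2 * c * (a - c)"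
    then show ?thesis using tight ne by simp
  qed
qed

text \<open>A complete cycle may be rerouted so that any prescribed arc becomes an arc of the factor; here
  this is done by conjugating with a transposition.\<close>

lemma complete_orbit_no_exchange:
  assumes v: "v \<in> V"
  defines "C \<equiv> orbit \<sigma> v"
  assumes complete: "\<And>w z. w \<in> C \<Longrightarrow> z \<in> C \<Longrightarrow> w \<in> X \<longleftrightarrow> z \<notin> X \<Longrightarrow> E w z"
    and u: "u \<in> C" and z: "z \<in> C" and t: "t \<in> V" "t \<notin> C" and arcs: "E u (\<sigma> t)" "E t z"
  shows False
proof -
  have CV: "C \<subseteq> V" using orb_V[OF v] by (simp add: C_def)
  have flip: "\<sigma> w \<in> X \<longleftrightarrow> w \<notin> X" if "w \<in> V" for w using \<sigma>_X \<sigma>_Y disj that by blast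
  have flipE: "w \<in> X \<longleftrightarrow> s \<notin> X" if "E w s" for w s using bip[OF that] disj by blast
  have \<sigma>C: "\<sigma> w \<in> C \<longleftrightarrow> w \<in> C" for w by (simp add: C_def orb_step)
  have uz: "u \<in> X \<longleftrightarrow> z \<notin> X"
    using flipE[OF arcs(1)] flipE[OF arcs(2)] flip[OF t(1)] by blast
  \<comment> \<open>Exchanging \<open>z\<close> with the old successor of \<open>u\<close> makes
    \<open>z\<close> the new successor of \<open>u\<close>. Both lie on the same side, so
    completeness keeps the conjugate a cycle factor.\<close>
  define \<pi> where "\<pi> = transpose z (\<sigma> u)"
  have inv: "\<pi> (\<pi> w) = w" for w by (simp add: \<pi>_def)
  have same: "\<pi> w \<in> X \<longleftrightarrow> w \<in> X" for w
    using flip[of u] u CV uz by (auto simp: \<pi>_def transpose_def)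
  have \<pi>C: "\<pi> w \<in> C \<longleftrightarrow> w \<in> C" for w
    using z u \<sigma>C by (auto simp: \<pi>_def transpose_def)
  have \<pi>_out: "\<pi> w = w" if "w \<notin> C" for w using that z u \<sigma>C by (auto simp: \<pi>_def transpose_def)
  have \<pi>_perm: "\<pi> permutes V" unfolding \<pi>_def using z u \<sigma>C CV by (intro permutes_swap_id) auto
  define \<tau> where "\<tau> = \<pi> \<circ> \<sigma> \<circ> \<pi>"
  have fac: "cycle_factor V E \<tau>"
    unfolding cycle_factor_def
  proof (intro conjI ballI)
    show "\<tau> permutes V" unfolding \<tau>_def by (intro permutes_compose perm \<pi>_perm)
    fix w assume w: "w \<in> V"
    show "E w (\<tau> w)"
    proof (cases "w \<in> C")
      case True
      then have "\<tau> w \<in> C" "\<tau> w \<in> X \<longleftrightarrow> w \<notin> X"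
        using \<sigma>C \<pi>C same flip[of "\<pi> w"] CV by (auto simp: \<tau>_def)
      then show ?thesis using complete True by blast
    next
      case False
      then show ?thesis using \<pi>_out \<sigma>C E_\<sigma>[OF w] by (simp add: \<tau>_def)
    qed
  qed
  have orb: "orbit \<tau> w = \<pi> ` orbit \<sigma> (\<pi> w)" for w unfolding \<tau>_def using inv by (rule orbit_conj)
  \<comment> \<open>Conjugation maps orbits to orbits, so the new factor is maximal as well and
    \<open>no_exchange\<close> applies to it.\<close>
  have "orbit_rel V \<sigma> \<subseteq> map_prod \<pi> \<pi> ` orbit_rel V \<tau>"
  proof
    fix x assume "x \<in> orbit_rel V \<sigma>"
    then obtain s t where st: "x = (s, t)" "s \<in> V" "t \<in> orbit \<sigma> s" by (auto simp: orbit_rel_def)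
    then have "\<pi> s \<in> V" "\<pi> t \<in> orbit \<tau> (\<pi> s)"
      using permutes_in_image[OF \<pi>_perm] by (auto simp: orb inv)
    then have "(\<pi> s, \<pi> t) \<in> orbit_rel V \<tau>" by (simp add: orbit_rel_def)
    then show "x \<in> map_prod \<pi> \<pi> ` orbit_rel V \<tau>"
      using st(1) inv by (intro image_eqI[of _ _ "(\<pi> s, \<pi> t)"]) auto
  qed
  then have card_ge: "card (orbit_rel V \<sigma>) \<le> card (orbit_rel V \<tau>)"
    using orbit_rel_finite(2)[of \<tau> V] fac finV by (meson cycle_factor_def surj_card_le)
  interpret conj: maximal_factor X Y E a \<tau>
    by unfold_locales (use fac not_ham maximal card_ge le_trans in blast)+
  have "u \<noteq> z" "u \<noteq> \<sigma> u" using uz flip[of u] u CV by auto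
  then have \<pi>u: "\<pi> u = u" by (simp add: \<pi>_def)
  have "orbit \<tau> u = \<pi> ` C" using orb_eq u by (simp add: orb \<pi>u C_def)
  then have "t \<notin> orbit \<tau> u" using t(2) \<pi>C by auto
  moreover have "\<tau> t = \<sigma> t" using \<pi>_out t(2) \<sigma>C by (simp add: \<tau>_def)
  moreover have "\<tau> u = z" using \<pi>u by (simp add: \<tau>_def \<pi>_def)
  ultimately show False using conj.no_exchange[of u t] u CV arcs by auto
qed

text \<open>By \<open>complete_orbit_no_exchange\<close>, if \<open>t\<close> off the cycle has any
  arc into it, then no arc goes from the cycle to \<open>\<sigma> t\<close>. The degree bound
  exceeds what \<open>\<sigma> t\<close> can collect off the cycle, so \<open>\<sigma> t\<close> has
  an arc into the cycle too. This propagates around the only other cycle, and then no arc can leave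
  the complete one.\<close>

lemma complete_orbit_absurd:
  assumes v: "v \<in> V" and single: "\<And>w. w \<in> V - orbit \<sigma> v \<Longrightarrow> orbit \<sigma> w = V - orbit \<sigma> v"
    and complete: "\<And>w z. w \<in> orbit \<sigma> v \<Longrightarrow> z \<in> orbit \<sigma> v \<Longrightarrow> w \<in> X \<longleftrightarrow> z \<notin> X \<Longrightarrow> E w z"
    and deg_gt: "\<And>w. w \<in> V - orbit \<sigma> v \<Longrightarrow> 2 * (a - card (X \<inter> orbit \<sigma> v)) < deg w"
  shows False
proof -
  let ?C = "orbit \<sigma> v"
  have no: False if "u \<in> ?C" "z \<in> ?C" "t \<in> V" "t \<notin> ?C" "E u (\<sigma> t)" "E t z" for u z t
    using complete_orbit_no_exchange[OF v _ that] complete by blast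
  define A where "A w \<longleftrightarrow> (\<exists>z\<in>?C. E w z)" for w
  have step: "\<sigma> w \<in> {w \<in> V - ?C. A w}" if w: "w \<in> V - ?C" "A w" for w
  proof -
    have sw: "\<sigma> w \<in> V - ?C" using w \<sigma>_in orb_step by blast
    have "card (X \<inter> (V - ?C)) \<le> a - card (X \<inter> ?C)" "card (Y \<inter> (V - ?C)) \<le> a - card (X \<inter> ?C)"
    proof -
      have "X \<inter> (V - ?C) = X - X \<inter> ?C" "Y \<inter> (V - ?C) = Y - Y \<inter> ?C" by auto
      then show "card (X \<inter> (V - ?C)) \<le> a - card (X \<inter> ?C)" "card (Y \<inter> (V - ?C)) \<le> a - card (X \<inter> ?C)"
        using card_Diff_subset[of "X \<inter> ?C" X] card_Diff_subset[of "Y \<inter> ?C" Y] finX finY cardX cardY card_orbit_halves[of v]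
        by simp_all
    qed
    note le = restricted_nbs_le[OF this, of "\<sigma> w"]
    have "\<exists>z\<in>?C. E (\<sigma> w) z \<or> E z (\<sigma> w)"
    proof (rule ccontr)
      assume n: "\<not> ?thesis"
      then have "{z. E (\<sigma> w) z} = {z\<in>V - ?C. E (\<sigma> w) z}" "{z. E z (\<sigma> w)} = {z\<in>V - ?C. E z (\<sigma> w)}"
        using EV by blast+
      then have "deg (\<sigma> w) \<le> 2 * (a - card (X \<inter> ?C))" using le by (simp add: degree_def)
      then show False using deg_gt[OF sw] by simp
    qed
    moreover have "\<not> E z (\<sigma> w)" if "z \<in> ?C" for z
      using no[OF that, of _ w] w unfolding A_def by blast
    ultimately show ?thesis using sw by (auto simp: A_def)
  qed
  obtain s z where s: "s \<in> V - ?C" "z \<in> ?C" "E s z" using arc_into_orbit[OF v] by metis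
  have "orbit \<sigma> s \<subseteq> {w \<in> V - ?C. A w}"
    by (rule orbit_closed_subset) (use s step in \<open>auto simp: A_def\<close>)
  then have all: "A w" if "w \<in> V - ?C" for w using single[OF s(1)] that by blast
  obtain u w where uw: "u \<in> ?C" "w \<in> V - ?C" "E u w" using arc_out_of_orbit[OF v] by metis
  then obtain t where t: "t \<in> V" "\<sigma> t = w" using \<sigma>_pred by blast
  then have "t \<in> V - ?C" using uw(2) orb_step by blast
  then show False using no[OF uw(1), of _ t] all[of t] t(2) uw(3) unfolding A_def by blast
qed

text \<open>The shorter of two cycles satisfies \<open>2 * c \<le> a\<close>, so
  \<open>orbit_cases\<close> applies. Since \<open>a \<le> c + 3\<close> and every cycle has at
  least two vertices of \<open>X\<close>, there are only two cycles; what remains is to supply the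
  degree bound of \<open>complete_orbit_absurd\<close> or to find two low-degree vertices with a
  common out-neighbour.\<close>

lemma not_a_ge_4: "\<not> a \<ge> 4"
proof
  assume a4: "a \<ge> 4"
  have "\<exists>v\<in>V. 2 * card (X \<inter> orbit \<sigma> v) \<le> a"
  proof -
    obtain v where v: "v \<in> V" using cardX a4 by (metis UnI1 card.empty ex_in_conv not_numeral_le_zero)
    then obtain w where w: "w \<in> V" "w \<notin> orbit \<sigma> v" using orbit_ne_V orb_V by blast
    have "2 * card (X \<inter> orbit \<sigma> v) \<le> a \<or> 2 * card (X \<inter> orbit \<sigma> w) \<le> a"
      using disjoint_orbits_half[OF v w] by linarith
    then show ?thesis using v w by blast
  qed
  then obtain v where v: "v \<in> V" "2 * card (X \<inter> orbit \<sigma> v) \<le> a" by blast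
  let ?C = "orbit \<sigma> v" and ?c = "card (X \<inter> orbit \<sigma> v)"
  have c2: "2 \<le> card (X \<inter> orbit \<sigma> w)" if "w \<in> V" for w using orbit_half_ge_2[OF a4 that] .
  have "a \<le> ?c + 3" using orbit_cases[OF a4 v] by auto
  have single: "orbit \<sigma> w = V - ?C" if w: "w \<in> V - ?C" for w
  proof (rule ccontr)
    assume ne: "\<not> ?thesis"
    have "orbit \<sigma> w \<subseteq> V - ?C" using orb_V[of w] orb_eq[of _ w] orb_eq[of _ v] orb_self w by blast
    then obtain u where u: "u \<in> V" "u \<notin> ?C" "u \<notin> orbit \<sigma> w" using ne by blast
    then show False using half_le_outside[OF v(1), of w u] w c2[of w] c2[of u] \<open>a \<le> ?c + 3\<close> by simp
  qed
  \<comment> \<open>Either arc makes \<open>s\<close> and \<open>p\<close> a dominating pair,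
    meeting in \<open>\<sigma> p\<close> or in \<open>\<sigma> s\<close>.\<close>
  have nb_big: "2 * a - 2 \<le> deg p"
    if "s \<in> nonbig S" "S \<subseteq> V" "p \<in> V" "s \<noteq> p" "E s (\<sigma> p) \<or> E p (\<sigma> s)" for s S p
  proof -
    have "s \<in> V" using that by (auto simp: nonbig_def)
    have small: "\<not> 2 * a - 2 \<le> deg s" using that(1) by (simp add: nonbig_def)
    from that(5) show ?thesis
    proof
      assume "E s (\<sigma> p)"
      from dom[OF this E_\<sigma>[OF that(3)] that(4)] small show ?thesis by blast
    next
      assume "E p (\<sigma> s)"
      from dom[OF E_\<sigma>[OF \<open>s \<in> V\<close>] this that(4)] small show ?thesis by blast
    qed
  qed
  have XCV: "X \<inter> C \<subseteq> V" "Y \<inter> C \<subseteq> V" for C by auto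
  from orbit_cases[OF a4 v] consider
    (wide) s s' where "a = ?c + 3" "s \<in> nonbig (X \<inter> ?C)" "s' \<in> nonbig (Y \<inter> ?C)"
      "\<forall>w\<in>?C. \<forall>z\<in>?C. (w \<in> X \<longleftrightarrow> z \<notin> X) \<longrightarrow> E w z"
      "\<forall>u\<in>?C. \<forall>p\<in>V - ?C. (p \<in> X \<longleftrightarrow> u \<in> X) \<longrightarrow> E u (\<sigma> p) \<or> E p (\<sigma> u)"
  | (four) "a = 4" "?c = 2" "\<forall>w\<in>?C. \<forall>z\<in>?C. (w \<in> X \<longleftrightarrow> z \<notin> X) \<longrightarrow> E w z"
  | (tight) s where "a = 4" "?c = 2" "s \<in> nonbig (X \<inter> ?C)"
      "\<forall>u\<in>?C. \<forall>p\<in>V - ?C. (p \<in> X \<longleftrightarrow> u \<in> X) \<longrightarrow> E u (\<sigma> p) \<or> E p (\<sigma> u)"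
    by blast
  then show False
  proof cases
    case wide
    have "2 * a - 2 \<le> deg w" if w: "w \<in> V - ?C" for w
    proof (cases "w \<in> X")
      case True
      have "s \<in> ?C" "s \<in> X" using wide(2) by (auto simp: nonbig_def)
      then show ?thesis using nb_big[OF wide(2) XCV(1), of w] wide(5) w True by blast
    next
      case False
      have "s' \<in> ?C" "s' \<notin> X" using wide(3) disj by (auto simp: nonbig_def)
      then show ?thesis using nb_big[OF wide(3) XCV(2), of w] wide(5) w False by blast
    qed
    moreover have "2 * (a - ?c) < 2 * a - 2" using wide(1) c2[OF v(1)] by simp
    ultimately have gt: "2 * (a - ?c) < deg w" if "w \<in> V - ?C" for w
      using that less_le_trans by blast
    show False
      by (rule complete_orbit_absurd[OF v(1) _ _ gt]) (use single wide(4) in blast)+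
  next
    case four
    have gt: "2 * (a - ?c) < deg w" if "w \<in> V - ?C" for w
      using no_small[OF a4, of w] that four(1,2) by simp
    show False
      by (rule complete_orbit_absurd[OF v(1) _ _ gt]) (use single four(3) in blast)+
  next
    case tight
    \<comment> \<open>The other cycle also has half-length 2, so \<open>orbit_cases\<close> applies
      to it too. If it is complete, the roles of the cycles are exchanged; if it has a low-degree
      vertex \<open>t\<close> in \<open>X\<close>, tightness gives \<open>s\<close> and
      \<open>t\<close> a common out-neighbour.\<close>
    obtain w where w: "w \<in> V" "w \<notin> ?C" using orbit_ne_V[OF v(1)] orb_V[OF v(1)] by blast
    have orbw: "orbit \<sigma> w = V - ?C" using single w by blast
    then have out: "V - orbit \<sigma> w = ?C" using orb_V[OF v(1)] by blast
    have "X \<inter> orbit \<sigma> w = X - X \<inter> ?C" using orbw by auto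
    then have cw: "card (X \<inter> orbit \<sigma> w) = 2"
      using card_Diff_subset[of "X \<inter> ?C" X] finX cardX tight(1,2) by simp
    then consider
      (complete) "\<forall>u\<in>orbit \<sigma> w. \<forall>z\<in>orbit \<sigma> w. (u \<in> X \<longleftrightarrow> z \<notin> X) \<longrightarrow> E u z"
    | (nonbig) t where "t \<in> nonbig (X \<inter> orbit \<sigma> w)"
      using orbit_cases[OF a4 w(1)] tight(1) by auto
    then show False
    proof cases
      case complete
      have gt: "2 * (a - card (X \<inter> orbit \<sigma> w)) < deg u" if "u \<in> V - orbit \<sigma> w" for u
        using no_small[OF a4, of u] that tight(1) cw by simp
      have single': "orbit \<sigma> u = V - orbit \<sigma> w" if "u \<in> V - orbit \<sigma> w" for u
        using that orb_eq unfolding out by blast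
      show False
        by (rule complete_orbit_absurd[OF w(1) _ _ gt]) (use single' complete in blast)+
    next
      case nonbig
      then have t: "t \<in> X" "t \<in> V - ?C" "deg t < 2 * a - 2" using orbw by (auto simp: nonbig_def)
      have s: "s \<in> X" "s \<in> ?C" using tight(3) by (auto simp: nonbig_def)
      then have "E s (\<sigma> t) \<or> E t (\<sigma> s)" using tight(4) t by blast
      then show False using nb_big[OF tight(3) XCV(1), of t] s t by auto
    qed
  qed
qed

end

section \<open>Small orders\<close>

lemma isomorphic_copy_H1:
  assumes "distinct [p, q, r, s]" "V = {p, q, r, s}"
    and "E p q" "E q p" "E q r" "E r q" "E r s" "E s r" "\<not> E p s" "\<not> E s p"
    and "\<And>u v. u \<in> {p, r} \<and> v \<in> {p, r} \<or> u \<in> {q, s} \<and> v \<in> {q, s} \<Longrightarrow> \<not> E u v"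
  shows "isomorphic_copy V E H1"
proof -
  define g where "g h = (case h of x1 \<Rightarrow> p | y1 \<Rightarrow> q | x2 \<Rightarrow> r | _ \<Rightarrow> s)" for h
  have "bij_betw g (verts H1) V"
    using assms(1,2) by (auto simp: bij_betw_def inj_on_def g_def H1_def)
  moreover have "\<forall>h\<in>verts H1. \<forall>k\<in>verts H1. (h, k) \<in> arcs H1 \<longleftrightarrow> E (g h) (g k)"
    using assms(3-) by (auto simp: g_def H1_def both_ways_def)
  ultimately show ?thesis unfolding isomorphic_copy_def by blast
qed

lemma isomorphic_copy_H3:
  assumes "distinct [p, q, r, s, t, u]" "V = {p, q, r, s, t, u}"
    and "E u p" "E p u" "E u q" "E q u" "E r s" "E s r" "E r t" "E t r" "E p t" "E t q" "E q s" "E s p"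
    and "\<not> E t p" "\<not> E q t" "\<not> E s q" "\<not> E p s" "\<not> E u r" "\<not> E r u"
    and nE: "\<And>v w. v \<in> {p, q, r} \<and> w \<in> {p, q, r} \<or> v \<in> {s, t, u} \<and> w \<in> {s, t, u} \<Longrightarrow> \<not> E v w"
  shows "isomorphic_copy V E H3"
proof -
  define g where "g h = (case h of x1 \<Rightarrow> p | x2 \<Rightarrow> q | x3 \<Rightarrow> r | y1 \<Rightarrow> s | y2 \<Rightarrow> t | y3 \<Rightarrow> u)" for h
  have g: "g x1 = p" "g x2 = q" "g x3 = r" "g y1 = s" "g y2 = t" "g y3 = u"
    by (simp_all add: g_def)
  have "inj_on g (verts H3)"
  proof (rule inj_onI)
    fix h k assume "g h = g k" then show "h = k" using assms(1) by (cases h; cases k) (auto simp: g)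
  qed
  moreover have "g ` verts H3 = V" using assms(2) unfolding verts_H3 UNIV_hvert by (simp add: g)
  moreover have "(h, k) \<in> arcs H3 \<longleftrightarrow> E (g h) (g k)" for h k
    using assms(3-20) nE by (cases h; cases k) (auto simp: g H3_def both_ways_def)
  ultimately show ?thesis unfolding isomorphic_copy_def bij_betw_def by blast
qed

context maximal_factor begin

text \<open>The factor consists of two 2-cycles. Strongness needs an arc in each direction between
  them and \<open>no_exchange\<close> rules out the crossing pairs, so these two arcs must join the
  same two vertices, giving a path with all edges doubled.\<close>

lemma H1_if_a_eq_2:
  assumes "a = 2"
  shows "isomorphic_copy V E H1"
proof -
  obtain x x' where X: "X = {x, x'}" "x \<noteq> x'" using cardX assms by (auto simp: card_2_iff)
  define y y' where "y = \<sigma> x" and "y' = \<sigma> x'"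
  have ne: "y \<noteq> y'" using X(2) \<sigma>_inj by (simp add: y_def y'_def)
  have yY: "y \<in> Y" "y' \<in> Y" using \<sigma>_X X by (auto simp: y_def y'_def)
  have Y: "Y = {y, y'}"
    using card_subset_eq[OF finY, of "{y, y'}"] yY ne cardY assms by simp
  have inV: "x \<in> X" "x' \<in> X" "x \<in> V" "x' \<in> V" "y \<in> V" "y' \<in> V" using X yY by auto
  have XY: "s \<noteq> t" if "s \<in> X" "t \<in> Y" for s t using that disj by blast
  have Veq: "V = {x, x', y, y'}" unfolding X(1) Y by auto
  have "\<sigma> y \<noteq> x'"
  proof
    assume "\<sigma> y = x'"
    then have "{x, x', y, y'} \<subseteq> orbit \<sigma> x"
      using orb_self[of x] orb_step unfolding y_def y'_def by (metis empty_subsetI insert_subset)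
    then show False using orbit_ne_V[OF inV(3)] orb_V[OF inV(3)] Veq by auto
  qed
  moreover have "\<sigma> y \<in> {x, x'}" using \<sigma>_Y[OF yY(1)] X(1) by blast
  ultimately have sy: "\<sigma> y = x" by blast
  have "\<sigma> y' \<noteq> x" using sy ne \<sigma>_inj by metis
  moreover have "\<sigma> y' \<in> {x, x'}" using \<sigma>_Y[OF yY(2)] X(1) by blast
  ultimately have sy': "\<sigma> y' = x'" by blast
  have orb: "orbit \<sigma> x = {x, y}" using two_cycle_orbit[of x] sy by (simp add: y_def)
  have orby: "orbit \<sigma> y = {x, y}" using orb_eq[of y x] orb by auto
  have arcs: "E x y" "E y x" "E x' y'" "E y' x'"
    using E_\<sigma>[OF inV(3)] E_\<sigma>[OF inV(4)] E_\<sigma>[OF inV(5)] E_\<sigma>[OF inV(6)] sy sy'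
    by (simp_all add: y_def y'_def)
  have dist: "x' \<noteq> y" "x \<noteq> y'" "x \<noteq> y" "x' \<noteq> y'" using XY inV yY by blast+
  have ex1: "\<not> (E x y' \<and> E x' y)"
    using no_exchange[of x x'] inV orb X(2) dist by (auto simp: y_def y'_def)
  have ex2: "\<not> (E y x' \<and> E y' x)"
    using no_exchange[of y y'] inV orby ne dist sy sy' by auto
  have nE: "\<not> E s t" if "s \<in> X \<and> t \<in> X \<or> s \<in> Y \<and> t \<in> Y" for s t using bip[of s t] disj that by blast
  then have nE: "\<not> E s t" if "s \<in> {x, x'} \<and> t \<in> {x, x'} \<or> s \<in> {y, y'} \<and> t \<in> {y, y'}" for s t
    using that unfolding X(1) Y by blast
  have mem: "s \<in> {x', y'}" if "s \<in> V - {x, y}" for s using that unfolding Veq by blast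
  have out: "E x y' \<or> E y x'"
  proof -
    obtain s t where "s \<in> {x, y}" "t \<in> V - {x, y}" "E s t" using arc_out_of_orbit[OF inV(3)] orb by metis
    then show ?thesis using mem[of t] nE[of s t] by blast
  qed
  have into: "E x' y \<or> E y' x"
  proof -
    obtain s t where "s \<in> V - {x, y}" "t \<in> {x, y}" "E s t" using arc_into_orbit[OF inV(3)] orb by metis
    then show ?thesis using mem[of s] nE[of s t] by blast
  qed
  show ?thesis
  proof (cases "E x y'")
    case True
    then have "\<not> E x' y" "E y' x" "\<not> E y x'" using ex1 ex2 into by blast+
    then show ?thesis
      using True arcs nE dist ne X(2) Veq by (intro isomorphic_copy_H1[of y x y' x']) auto
  next
    case False
    then have "E y x'" "\<not> E y' x" "E x' y" using ex2 into out by blast+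
    then show ?thesis
      using False arcs nE dist ne X(2) Veq by (intro isomorphic_copy_H1[of x y x' y']) auto
  qed
qed

text \<open>The arcs between different 2-cycles form two tournaments on the three cycles. By strongness
  both are cyclic, and one of the three resulting hexagons is a Hamiltonian cycle.\<close>

lemma no_three_two_cycles:
  assumes a3: "a = 3" and X: "X = {p, q, r}" "distinct [p, q, r]"
    and inv: "\<sigma> (\<sigma> p) = p" "\<sigma> (\<sigma> q) = q" "\<sigma> (\<sigma> r) = r"
  shows False
proof -
  interpret sw: maximal_factor Y X E a \<sigma> by (rule swap_maximal)
  define p' q' r' where "p' = \<sigma> p" and "q' = \<sigma> q" and "r' = \<sigma> r"
  note defs = p'_def q'_def r'_def
  have pX: "p \<in> X" "q \<in> X" "r \<in> X" using X by auto
  have pY: "p' \<in> Y" "q' \<in> Y" "r' \<in> Y" using \<sigma>_X pX by (auto simp: defs)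
  have closes: "\<sigma> p' = p" "\<sigma> q' = q" "\<sigma> r' = r" using inv by (simp_all add: defs)
  have dist': "distinct [p', q', r']" using X(2) \<sigma>_inj by (simp add: defs)
  have Y: "Y = {p', q', r'}"
    using card_subset_eq[OF finY, of "{p', q', r'}"] pY dist' cardY a3 by simp
  have XY: "s \<noteq> t" if "s \<in> X" "t \<in> Y" for s t using that disj by blast
  note ne = XY[OF pX(1) pY(1)] XY[OF pX(1) pY(2)] XY[OF pX(1) pY(3)]
    XY[OF pX(2) pY(1)] XY[OF pX(2) pY(2)] XY[OF pX(2) pY(3)]
    XY[OF pX(3) pY(1)] XY[OF pX(3) pY(2)] XY[OF pX(3) pY(3)]
  have dist: "distinct [p, q, r, p', q', r']" using X(2) dist' ne by simp
  have arcs: "E p p'" "E p' p" "E q q'" "E q' q" "E r r'" "E r' r"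
    using E_\<sigma> pX pY closes by (metis UnI1 UnI2 defs)+
  have a3': "a \<ge> 3" using a3 by simp
  have tour: "E s (\<sigma> t) \<longleftrightarrow> \<not> E t (\<sigma> s)" if "s \<in> X" "t \<in> X" "s \<noteq> t" "\<sigma> (\<sigma> s) = s" for s t
    using two_cycle_tight(2)[OF a3' _ that(4), of t] that XY \<sigma>_X by blast
  have tour': "E s (\<sigma> t) \<longleftrightarrow> \<not> E t (\<sigma> s)" if "s \<in> Y" "t \<in> Y" "s \<noteq> t" "\<sigma> (\<sigma> s) = s" for s t
    using sw.two_cycle_tight(2)[OF a3' _ that(4), of t] that XY \<sigma>_Y by blast
  have T: "E p q' \<longleftrightarrow> \<not> E q p'" "E q r' \<longleftrightarrow> \<not> E r q'" "E r p' \<longleftrightarrow> \<not> E p r'"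
    using tour[OF pX(1,2)] tour[OF pX(2,3)] tour[OF pX(3,1)] X(2) inv unfolding defs by auto
  have T': "E p' q \<longleftrightarrow> \<not> E q' p" "E q' r \<longleftrightarrow> \<not> E r' q" "E r' p \<longleftrightarrow> \<not> E p' r"
    using tour'[OF pY(1,2)] tour'[OF pY(2,3)] tour'[OF pY(3,1)] dist' closes defs by auto
  have mixed: "\<exists>u\<in>{p, q, r} - {s}. E u (\<sigma> s)" if "s \<in> X" "\<sigma> (\<sigma> s) = s" for s
    using two_cycle_mixed(1)[OF a3' that] X(1) by simp
  have M: "E q p' \<or> E r p'" "E p q' \<or> E r q'" "E p r' \<or> E q r'"
    using mixed[OF pX(1) inv(1)] mixed[OF pX(2) inv(2)] mixed[OF pX(3) inv(3)] unfolding defs by blast+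
  have mixed': "\<exists>u\<in>{p', q', r'} - {s}. E u (\<sigma> s)" if "s \<in> Y" "\<sigma> (\<sigma> s) = s" for s
    using sw.two_cycle_mixed(1)[OF a3' that] Y by simp
  have M': "E q' p \<or> E r' p" "E p' q \<or> E r' q" "E p' r \<or> E q' r"
    using mixed'[OF pY(1)] mixed'[OF pY(2)] mixed'[OF pY(3)] unfolding closes defs[symmetric] by blast+
  have ham: False if "distinct vs" "set vs = {p, q, r, p', q', r'}" "successively E vs" "E (last vs) (hd vs)" for vs
  proof -
    have "vs \<noteq> []" "set vs = V" using that(2) X(1) Y by auto
    then show False using that not_ham unfolding hamiltonian_list_def by blast
  qed
  \<comment> \<open>Each tournament has one of two cyclic orientations. The first two cases
    alternate one tournament with arcs of the 2-cycles; in the third, the two tournaments alternate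
    with each other.\<close>
  consider "E q p'" "E r q'" "E p r'" | "E q' p" "E r' q" "E p' r"
    | "E p q'" "E q r'" "E r p'" "E p' q" "E q' r" "E r' p"
    using T T' M M' by blast
  then show False
  proof cases
    case 1
    then show False using ham[of "[p, r', r, q', q, p']"] arcs dist by auto
  next
    case 2
    then show False using ham[of "[p, p', r, r', q, q']"] arcs dist by auto
  next
    case 3
    then show False using ham[of "[p, q', r, p', q, r']"] arcs dist by auto
  qed
qed

text \<open>Tightness and \<open>two_cycle_mixed\<close> leave two possibilities for the arcs
  between the 2-cycle and the 4-cycle. In each, one vertex (\<open>q\<close> or \<open>p'\<close>)
  misses both arcs on the 2-cycle but has degree at least 4 by a dominating pair, so all its other
  arcs are present. The two arcs still open would each complete a Hamiltonian cycle.\<close>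

lemma H3_two_plus_four:
  assumes a3: "a = 3" and X: "X = {x, p, q}" "distinct [x, p, q]"
    and inv: "\<sigma> (\<sigma> x) = x" "\<sigma> (\<sigma> p) = q" "\<sigma> (\<sigma> q) = p" and py: "E p (\<sigma> x)"
  shows "isomorphic_copy V E H3"
proof -
  interpret sw: maximal_factor Y X E a \<sigma> by (rule swap_maximal)
  define y p' q' where "y = \<sigma> x" and "p' = \<sigma> p" and "q' = \<sigma> q"
  note defs = y_def p'_def q'_def
  have pX: "x \<in> X" "p \<in> X" "q \<in> X" using X by auto
  have pY: "y \<in> Y" "p' \<in> Y" "q' \<in> Y" using \<sigma>_X pX by (auto simp: defs)
  have closes: "\<sigma> y = x" "\<sigma> p' = q" "\<sigma> q' = p" using inv by (simp_all add: defs)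
  have dist': "distinct [y, p', q']" using X(2) \<sigma>_inj by (simp add: defs)
  have Y: "Y = {y, p', q'}"
    using card_subset_eq[OF finY, of "{y, p', q'}"] pY dist' cardY a3 by simp
  have XY: "s \<noteq> t" if "s \<in> X" "t \<in> Y" for s t using that disj by blast
  note ne = XY[OF pX(1) pY(1)] XY[OF pX(1) pY(2)] XY[OF pX(1) pY(3)]
    XY[OF pX(2) pY(1)] XY[OF pX(2) pY(2)] XY[OF pX(2) pY(3)]
    XY[OF pX(3) pY(1)] XY[OF pX(3) pY(2)] XY[OF pX(3) pY(3)]
  have dist: "distinct [x, p, q, y, p', q']" using X(2) dist' ne by simp
  have Veq: "V = {x, p, q, y, p', q'}" unfolding X(1) Y by auto
  have arcs: "E x y" "E y x" "E p p'" "E p' q" "E q q'" "E q' p"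
    using E_\<sigma> pX pY closes by (metis UnI1 UnI2 defs)+
  have py: "E p y" using py by (simp add: y_def)
  have a3': "a \<ge> 3" using a3 by simp
  have T: "E x (\<sigma> t) \<longleftrightarrow> \<not> E t y" if "t \<in> X" "t \<noteq> x" for t
    using two_cycle_tight(2)[OF a3' _ inv(1), of t] that pX XY pY unfolding y_def by blast
  have invy: "\<sigma> (\<sigma> y) = y" using closes by (simp add: y_def)
  have T': "E y (\<sigma> t) \<longleftrightarrow> \<not> E t x" if "t \<in> Y" "t \<noteq> y" for t
    using sw.two_cycle_tight(2)[OF a3' _ invy, of t] that pX XY pY unfolding closes by blast
  have "\<exists>u\<in>X - {x}. \<not> E u y" using two_cycle_mixed(2)[OF a3' pX(1) inv(1)] by (simp add: y_def)
  then have nqy: "\<not> E q y" using py X(1) by blast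
  have nxp': "\<not> E x p'" and xq': "E x q'"
    using T[of p] T[of q] pX X(2) py nqy by (auto simp: defs)
  have yq: "E y q \<longleftrightarrow> \<not> E p' x" and yp: "E y p \<longleftrightarrow> \<not> E q' x"
    using T'[of p'] T'[of q'] pY dist' closes by auto
  have "\<exists>u\<in>Y - {y}. E u x" "\<exists>u\<in>Y - {y}. \<not> E u x"
    using sw.two_cycle_mixed[OF a3' pY(1) invy] closes(1) by auto
  then have mix: "E p' x \<longleftrightarrow> \<not> E q' x" unfolding Y by blast
  have nE: "\<not> E s t" if "s \<in> X \<and> t \<in> X \<or> s \<in> Y \<and> t \<in> Y" for s t using bip[of s t] disj that by blast
  then have nE: "\<not> E s t" if "s \<in> {x, p, q} \<and> t \<in> {x, p, q} \<or> s \<in> {y, p', q'} \<and> t \<in> {y, p', q'}" for s t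
    using that unfolding X(1) Y by blast
  have ham: False if "distinct vs" "set vs = {x, p, q, y, p', q'}" "successively E vs" "E (last vs) (hd vs)" for vs
  proof -
    have "vs \<noteq> []" "set vs = V" using that(2) Veq by auto
    then show False using that not_ham unfolding hamiltonian_list_def by blast
  qed
  show ?thesis
  proof (cases "E p' x")
    case True
    then have nq'x: "\<not> E q' x" and nyq: "\<not> E y q" and yp: "E y p" using mix yq yp by blast+
    have "4 \<le> deg q" using dom[OF xq' arcs(5)] X(2) a3 by auto
    have qarcs: "E q p' \<and> E q' q"
    proof (rule ccontr)
      assume n: "\<not> ?thesis"
      then consider "\<not> E q p'" | "\<not> E q' q" by blast
      then show False
      proof cases
        case 1
        have "card {y} + card {y, p'} + deg q \<le> 2 * a"
          by (rule degree_misses) (use 1 nyq nqy pX pY XY in auto)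
        then show False using \<open>4 \<le> deg q\<close> a3 dist' by simp
      next
        case 2
        have "card {y, q'} + card {y} + deg q \<le> 2 * a"
          by (rule degree_misses) (use 2 nyq nqy pX pY XY in auto)
        then show False using \<open>4 \<le> deg q\<close> a3 dist' by auto
      qed
    qed
    have "\<not> E p q'"
    proof
      assume "E p q'"
      then show False using ham[of "[p, q', q, p', x, y]"] arcs True yp qarcs dist by auto
    qed
    moreover have "\<not> E p' p"
    proof
      assume "E p' p"
      then show False using ham[of "[p', p, y, x, q', q]"] arcs py xq' yp qarcs dist by auto
    qed
    ultimately show ?thesis
      using arcs py yp xq' True qarcs nq'x nxp' nyq nqy nE dist Veq
      by (intro isomorphic_copy_H3[of x p q p' q' y]) auto
  next
    case False
    then have q'x: "E q' x" and yq: "E y q" and nyp: "\<not> E y p" using mix yq yp by blast+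
    have "4 \<le> deg p'" using dom[OF yq arcs(4)] dist' a3 by auto
    have parcs: "E p' p \<and> E q p'"
    proof (rule ccontr)
      assume n: "\<not> ?thesis"
      have pX': "p \<in> X" "q \<in> X" "x \<in> X" "p' \<notin> X" using pX pY XY by auto
      from n consider "\<not> E p' p" | "\<not> E q p'" by blast
      then show False
      proof cases
        case 1
        have "card {x} + card {x, p} + deg p' \<le> 2 * a"
          by (rule degree_misses) (use 1 False nxp' pX' pY in auto)
        then show False using \<open>4 \<le> deg p'\<close> a3 X(2) by simp
      next
        case 2
        have "card {x, q} + card {x} + deg p' \<le> 2 * a"
          by (rule degree_misses) (use 2 False nxp' pX' pY in auto)
        then show False using \<open>4 \<le> deg p'\<close> a3 X(2) by auto
      qed
    qed
    have "\<not> E p q'"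
    proof
      assume "E p q'"
      then show False using ham[of "[p, q', x, y, q, p']"] arcs q'x yq parcs dist by auto
    qed
    moreover have "\<not> E q' q"
    proof
      assume "E q' q"
      then show False using ham[of "[q', q, p', p, y, x]"] arcs py xq' parcs dist by auto
    qed
    ultimately show ?thesis
      using arcs py yq q'x xq' parcs nyp nqy nxp' False nE dist Veq
      by (intro isomorphic_copy_H3[of p q x q' y p']) auto
  qed
qed

text \<open>\<open>\<sigma> \<circ> \<sigma>\<close> permutes the other two vertices of
  \<open>X\<close>. Fixing them means three 2-cycles; swapping them means a 4-cycle, on which
  \<open>p\<close> can be chosen with an arc to \<open>\<sigma> x\<close>.\<close>

lemma H3_if_a_eq_3_aux:
  assumes a3: "a = 3" and x: "x \<in> X" "\<sigma> (\<sigma> x) = x"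
  shows "isomorphic_copy V E H3"
proof -
  have a3': "a \<ge> 3" using a3 by simp
  have "card (X - {x}) = 2" using cardX a3 x finX by simp
  then obtain p q where pq: "X - {x} = {p, q}" "p \<noteq> q" by (auto simp: card_2_iff)
  then have X: "X = {x, p, q}" "distinct [x, p, q]" using x by auto
  have step: "\<sigma> (\<sigma> s) \<in> {p, q}" if "s \<in> {p, q}" for s
  proof -
    have "s \<in> X" "s \<noteq> x" using that pq by auto
    then have "\<sigma> (\<sigma> s) \<in> X" "\<sigma> (\<sigma> s) \<noteq> x" using \<sigma>_X \<sigma>_Y x(2) \<sigma>_inj by metis+
    then show ?thesis using pq by blast
  qed
  have inj: "\<sigma> (\<sigma> p) \<noteq> \<sigma> (\<sigma> q)" using pq(2) \<sigma>_inj by simp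
  show ?thesis
  proof (cases "\<sigma> (\<sigma> p) = p")
    case True
    then have "\<sigma> (\<sigma> q) = q" using step[of q] inj by auto
    then show ?thesis using no_three_two_cycles[OF a3 X x(2) True] by blast
  next
    case False
    then have sp: "\<sigma> (\<sigma> p) = q" and sq: "\<sigma> (\<sigma> q) = p" using step[of p] step[of q] inj by auto
    have "E p (\<sigma> x) \<or> E q (\<sigma> x)" using two_cycle_mixed(1)[OF a3' x] pq(1) by auto
    then show ?thesis
    proof
      assume "E p (\<sigma> x)"
      then show ?thesis using H3_two_plus_four[OF a3 X x(2) sp sq] by blast
    next
      assume "E q (\<sigma> x)"
      moreover have "X = {x, q, p}" "distinct [x, q, p]" using X by auto
      ultimately show ?thesis using H3_two_plus_four[OF a3 _ _ x(2) sq sp] by blast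
    qed
  qed
qed

text \<open>Three vertices of \<open>X\<close> spread over at least two cycles leave some cycle with
  only one of them, that is, a 2-cycle.\<close>

lemma H3_if_a_eq_3:
  assumes a3: "a = 3"
  shows "isomorphic_copy V E H3"
proof -
  have "X \<noteq> {}" using cardX a3 by auto
  then obtain v where v: "v \<in> V" by blast
  then obtain w where w: "w \<in> V" "w \<notin> orbit \<sigma> v" using orbit_ne_V[OF v] orb_V[OF v] by blast
  have "card (X \<inter> orbit \<sigma> v) = 1 \<or> card (X \<inter> orbit \<sigma> w) = 1"
    using disjoint_orbits_half[OF v w] orbit_half_pos[OF v] orbit_half_pos[OF w(1)] a3 by linarith
  then obtain s where s: "s \<in> V" "card (X \<inter> orbit \<sigma> s) = 1" using v w by blast
  then obtain x where x: "X \<inter> orbit \<sigma> s = {x}" by (auto simp: card_1_singleton_iff)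
  have xX: "x \<in> X" "x \<in> orbit \<sigma> s" using x by auto
  have "\<sigma> (\<sigma> x) \<in> X" using \<sigma>_X \<sigma>_Y xX by blast
  moreover have "\<sigma> (\<sigma> x) \<in> orbit \<sigma> s" using xX orb_step by simp
  ultimately have "\<sigma> (\<sigma> x) = x" using x by blast
  then show ?thesis using H3_if_a_eq_3_aux[OF a3 xX(1)] by blast
qed

end

theorem (in bipartite_dominating) hamiltonian_or_exceptional:
  "(\<exists>vs. hamiltonian_list V E vs) \<or> isomorphic_copy V E H1
    \<or> (\<exists>opt. isomorphic_copy V E (H2 opt)) \<or> isomorphic_copy V E H3"
proof (rule ccontr)
  assume no: "\<not> ?thesis"
  then obtain \<sigma>\<^sub>0 where "cycle_factor V E \<sigma>\<^sub>0" using exists_H2_or_factor by blast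
  then obtain \<sigma> where "maximal_factor X Y E a \<sigma>" using maximal_factor_exists no by blast
  then interpret maximal_factor X Y E a \<sigma> .
  from a2 not_a_ge_4 have "a = 2 \<or> a = 3" by linarith
  then show False using H1_if_a_eq_2 H3_if_a_eq_3 no by blast
qed

theorem theorem1p7:
  fixes D :: "('a, 'b) pre_digraph" and a :: nat
  assumes "a \<ge> 2"
    and "digraph D"
    and "strongly_connected D"
    and "balanced_bipartite D"
    and "card (verts D) = 2 * a"
    and "\<And>x y. dominating_pair D x y \<Longrightarrow>
           (total_degree D x \<ge> 2 * a - 2 \<and> total_degree D y \<ge> a + 1) \<or>
           (total_degree D y \<ge> 2 * a - 2 \<and> total_degree D x \<ge> a + 1)"
  shows "hamiltonian D \<or> digraph_iso D H1 \<or> (\<exists>opt. digraph_iso D (H2 opt)) \<or> digraph_iso D H3"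
proof -
  interpret digraph D by fact
  obtain X Y where XY: "verts D = X \<union> Y" "X \<inter> Y = {}" "independent_set D X" "independent_set D Y" "card X = card Y"
    using assms(4) by (auto simp: balanced_bipartite_def bipartition_def)
  have fin: "finite X" "finite Y" using finite_verts XY(1) by auto
  have card: "card X = a" "card Y = a"
    using card_Un_disjoint[OF fin XY(2)] XY(1,5) assms(5) by simp_all
  have deg: "degree (dominates D) v = total_degree D v" for v
    by (simp add: degree_def total_degree_conv)
  interpret bipartite_dominating X Y "dominates D" a
  proof
    fix u v assume "u \<rightarrow>\<^bsub>D\<^esub> v"
    then show "u \<in> X \<and> v \<in> Y \<or> u \<in> Y \<and> v \<in> X"
      using XY(1,3,4) adj_in_verts[of u v] by (auto simp: independent_set_def)
  next
    fix S assume "S \<subseteq> X \<union> Y" "S \<noteq> {}" "S \<noteq> X \<union> Y"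
    then show "\<exists>u\<in>S. \<exists>v\<in>X \<union> Y - S. u \<rightarrow>\<^bsub>D\<^esub> v"
      using strongly_connected_cut[OF assms(3)] XY(1) by simp
  next
    fix u v z assume "u \<rightarrow>\<^bsub>D\<^esub> z" "v \<rightarrow>\<^bsub>D\<^esub> z" "u \<noteq> v"
    then have "dominating_pair D u v" using adj_in_verts by (auto simp: dominating_pair_def)
    then show "2 * a - 2 \<le> degree (dominates D) u \<and> a + 1 \<le> degree (dominates D) v \<or>
        2 * a - 2 \<le> degree (dominates D) v \<and> a + 1 \<le> degree (dominates D) u"
      using assms(6) by (simp add: deg)
  qed (use assms(1) fin card XY(2) in auto)
  have iso: "digraph_iso D H" if "isomorphic_copy (X \<union> Y) (dominates D) H"
      "H = with_proj P" "arcs H \<subseteq> verts H \<times> verts H" for H :: "(hvert, hvert \<times> hvert) pre_digraph" and P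
    using digraph_iso_if_isomorphic_copy[OF _ that(2,3)] that(1) XY(1) by metis
  from hamiltonian_or_exceptional show ?thesis
  proof (elim disjE exE)
    fix vs assume "hamiltonian_list (X \<union> Y) (dominates D) vs"
    then show ?thesis using hamiltonian_if_list XY(1) by simp
  next
    assume "isomorphic_copy (X \<union> Y) (dominates D) H1"
    then have "digraph_iso D H1" by (rule iso[OF _ H1_def]) (auto simp: H1_def both_ways_def)
    then show ?thesis by blast
  next
    fix opt assume "isomorphic_copy (X \<union> Y) (dominates D) (H2 opt)"
    then have "digraph_iso D (H2 opt)"
      by (rule iso[OF _ H2_def]) (simp add: verts_H2)
    then show ?thesis by blast
  next
    assume "isomorphic_copy (X \<union> Y) (dominates D) H3"
    then have "digraph_iso D H3" by (rule iso[OF _ H3_def]) (simp add: verts_H3)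
    then show ?thesis by blast
  qed
qed

end
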